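(* Fix $0<r<t<S$ and $M>0$. There is a function $f_0\in\bigcap_{0<u<S}\mathcal F_u(M)$ such that, for every positive sequence $\delta_n=o\{\rho_n(r)\}$, $$\inf_{\phi_n}\left[\mathbb P_{f_0,1}(\phi_n=1)+\sup_{f\in\mathcal F_r(M),\ \operatorname{dist}_2(f,\mathcal B_t(M))\ge\delta_n}\mathbb P_{f,1}(\phi_n=0)\right]\longrightarrow1\qquad(n\to\infty),$$ where the infimum is over all tests $\phi_n$ based on the $n$ observations.
   Context: **Model.** Fix an integer $d\ge1$ and $\mathcal X=[0,1]^d$. For each $n$ one observes independent pairs $(X_i,Y_i)_{i=1}^n$ with $X_i\sim g$ and $Y_i\mid X_i=x\sim\mathrm{Bernoulli}(f(x))$; the law is $\mathbb P_{f,g}$, and $\mathbb P_{f,1}$ denotes the law under the uniform design density $g\equiv1$. A test is a measurable $\{0,1\}$-valued function of the observations. Write $\|h\|_2^2=\int_{\mathcal X}h(x)^2dx$ and $\operatorname{dist}_2(f,\mathcal A)=\inf_{h\in\mathcal A}\|f-h\|_2$. The testing rate is $\rho_n(s)=n^{-2s/(4s+d)}$. **Wavelets.** $S>0$ is fixed, together with a compactly supported, tensor-product, boundary-corrected orthonormal wavelet basis of Cohen–Daubechies–Vial type on $[0,1]^d$, built from a compactly supported orthonormal Daubechies system on $\mathbb R$ (scaling function $\varphi$, wavelet $\psi$) with Hölder–Zygmund regularity $R_{\mathrm w}>S$ and an integer number $N_{\mathrm w}>S$ of vanishing moments. Thus for an integer $J_0\ge0$ and every $j\ge J_0$ there are orthonormal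 families $(\varphi^I_{j,k})_{k\in\mathcal I_j}$, $(\psi^I_{j,k})_{k\in\mathcal I_j}$ in $L^2([0,1])$, $|\mathcal I_j|=2^j$, each consisting of the ordinary functions $2^{j/2}\varphi(2^jx-k)$ (resp. $2^{j/2}\psi(2^jx-k)$) with support in $(0,1)$ together with a number, independent of $j$, of boundary functions that are $L^2$-normalized level-$j$ dilates of fixed compactly supported prototypes; $J_0$ is large enough that left- and right-boundary functions have disjoint supports at every level $j\ge J_0$. The spans $V^I_j,W^I_j$ satisfy $V^I_{j+1}=V^I_j\oplus W^I_j$ (orthogonal), $L^2([0,1])=V^I_{J_0}\oplus\bigoplus_{j\ge J_0}W^I_j$, and $V^I_j$ contains all polynomials of degree at most $N_{\mathrm w}-1$. On $[0,1]^d$ put $\Lambda_j=\mathcal I_j^d$, $\varphi_{j,\lambda}(x)=\prod_{\ell=1}^d\varphi^I_{j,k_\ell}(x_\ell)$ for $\lambda=(k_1,\dots,k_d)$, $V_j=\operatorname{span}\{\varphi_{j,\lambda}:\lambda\in\Lambda_j\}$; $P_J$ is the $L^2(dx)$-orthogonal projection onto $V_J$ and $Q_j=P_{j+1}-P_j$. **Function classes.** For $u\ge0$, $\|h\|_{\mathbb B^u_{2,\infty}}=2^{J_0u}\|P_{J_0}h\|_2+\sup_{j\ge J_0}2^{ju}\|Q_jh\|_2$, $\mathcal B_u(M)=\{h\in L^2(dx):\|h\|_{\mathbb B^u_{2,\infty}}\le M\}$, and $\mathcal F_u(M)=\{f\in\mathcal B_u(M):0\le f\le1\text{ a.e.}\}$.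 *)

theory Defs
  imports
    "HOL-Probability.Probability"
    "HOL-Library.Landau_Symbols"
    "HOL-Computational_Algebra.Polynomial"
begin

text \<open>Elements of \<open>L\<^sup>2(M)\<close> are represented by functions; equality in \<open>L\<^sup>2(M)\<close> is equality
  almost everywhere, which is why the subspaces below are saturated under it.\<close>

definition l2_set :: "'a measure \<Rightarrow> ('a \<Rightarrow> real) set" where
  "l2_set M = {h \<in> borel_measurable M. integrable M (\<lambda>x. (h x)\<^sup>2)}"

definition l2_inner :: "'a measure \<Rightarrow> ('a \<Rightarrow> real) \<Rightarrow> ('a \<Rightarrow> real) \<Rightarrow> real" where
  "l2_inner M f g = (\<integral>x. f x * g x \<partial>M)"

definition l2_norm :: "'a measure \<Rightarrow> ('a \<Rightarrow> real) \<Rightarrow> real" where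
  "l2_norm M h = sqrt (\<integral>x. (h x)\<^sup>2 \<partial>M)"

definition l2_dist_set :: "'a measure \<Rightarrow> ('a \<Rightarrow> real) \<Rightarrow> ('a \<Rightarrow> real) set \<Rightarrow> real" where
  "l2_dist_set M f A = (INF h\<in>A. l2_norm M (\<lambda>x. f x - h x))"

definition l2_span :: "'a measure \<Rightarrow> ('a \<Rightarrow> real) set \<Rightarrow> ('a \<Rightarrow> real) set" where
  "l2_span M B = {h \<in> l2_set M. \<exists>F c. finite F \<and> F \<subseteq> B \<and>
     (AE x in M. h x = (\<Sum>b\<in>F. c b * b x))}"

text \<open>\<open>C = A \<oplus> B\<close> as an orthogonal direct sum of subspaces of \<open>L\<^sup>2(M)\<close>.\<close>

definition l2_orth_sum ::
    "'a measure \<Rightarrow> ('a \<Rightarrow> real) set \<Rightarrow> ('a \<Rightarrow> real) set \<Rightarrow> ('a \<Rightarrow> real) set \<Rightarrow> bool" where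
  "l2_orth_sum M C A B \<longleftrightarrow>
     (\<forall>a\<in>A. \<forall>b\<in>B. l2_inner M a b = 0) \<and>
     C = {h \<in> l2_set M. \<exists>a\<in>A. \<exists>b\<in>B. AE x in M. h x = a x + b x}"

definition l2_orthonormal :: "'a measure \<Rightarrow> 'i set \<Rightarrow> ('i \<Rightarrow> 'a \<Rightarrow> real) \<Rightarrow> bool" where
  "l2_orthonormal M I F \<longleftrightarrow> (\<forall>i\<in>I. F i \<in> l2_set M) \<and>
     (\<forall>i\<in>I. \<forall>k\<in>I. l2_inner M (F i) (F k) = (if i = k then 1 else 0))"

definition l2_onb :: "'a measure \<Rightarrow> 'i set \<Rightarrow> ('i \<Rightarrow> 'a \<Rightarrow> real) \<Rightarrow> bool" where
  "l2_onb M I F \<longleftrightarrow> l2_orthonormal M I F \<and>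
     (\<forall>h\<in>l2_set M. \<forall>e>0. \<exists>g\<in>l2_span M (F ` I). l2_norm M (\<lambda>x. h x - g x) < e)"

text \<open>For the finite-dimensional \<open>V\<close> used below the orthogonal projection exists and is unique up
  to null sets.\<close>

definition l2_proj :: "'a measure \<Rightarrow> ('a \<Rightarrow> real) set \<Rightarrow> ('a \<Rightarrow> real) \<Rightarrow> 'a \<Rightarrow> real" where
  "l2_proj M V h = (SOME p. p \<in> V \<and> (\<forall>v\<in>V. l2_inner M (\<lambda>x. h x - p x) v = 0))"

definition fsupp :: "(real \<Rightarrow> real) \<Rightarrow> real set" where
  "fsupp f = closure {x. f x \<noteq> 0}"

text \<open>The Hoelder--Zygmund space of order \<open>s > 0\<close>, written as \<open>s = m + a\<close> with \<open>m\<close> a natural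
  number and \<open>0 < a \<le> 1\<close>: bounded derivatives up to order \<open>m\<close>, the last of them with second
  differences of order \<open>a\<close>.  This is the usual Hoelder space for non-integer \<open>s\<close> and the Zygmund
  space for integer \<open>s\<close>.\<close>

definition hoelder_zygmund :: "real \<Rightarrow> (real \<Rightarrow> real) \<Rightarrow> bool" where
  "hoelder_zygmund s f \<longleftrightarrow> s > 0 \<and>
     (let m = nat \<lceil>s\<rceil> - 1; g = (deriv ^^ m) f in
       (\<forall>i<m. (deriv ^^ i) f differentiable_on UNIV) \<and>
       continuous_on UNIV g \<and>
       (\<forall>i\<le>m. bounded (range ((deriv ^^ i) f))) \<and>
       (\<exists>C. \<forall>x h. \<bar>g (x + h) - 2 * g x + g (x - h)\<bar> \<le> C * \<bar>h\<bar> powr (s - real m)))"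

definition dilate :: "(real \<Rightarrow> real) \<Rightarrow> nat \<Rightarrow> int \<Rightarrow> real \<Rightarrow> real" where
  "dilate \<eta> j k x = 2 powr (real j / 2) * \<eta> (2 ^ j * x - of_int k)"

text \<open>Compactly supported orthonormal scaling function and wavelet with finite two-scale filters,
  regularity \<open>R\<close> and \<open>N\<close> vanishing moments.  Minimality of the filter length is not demanded, so
  the extremal-phase, least-asymmetric and similar families are all covered, under any convention
  on integer shifts.\<close>

definition daubechies_system :: "nat \<Rightarrow> real \<Rightarrow> (real \<Rightarrow> real) \<Rightarrow> (real \<Rightarrow> real) \<Rightarrow> bool" where
  "daubechies_system N R \<phi> \<psi> \<longleftrightarrow>
     compact (fsupp \<phi>) \<and> compact (fsupp \<psi>) \<and>
     hoelder_zygmund R \<phi> \<and> hoelder_zygmund R \<psi> \<and>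
     (\<exists>K a. finite K \<and> (\<forall>x. \<phi> x = sqrt 2 * (\<Sum>k\<in>K. a k * \<phi> (2 * x - of_int k)))) \<and>
     (\<exists>K b. finite K \<and> (\<forall>x. \<psi> x = sqrt 2 * (\<Sum>k\<in>K. b k * \<phi> (2 * x - of_int k)))) \<and>
     (\<integral>x. \<phi> x \<partial>lborel) = 1 \<and>
     l2_onb lborel UNIV (case_sum (\<lambda>k. dilate \<phi> 0 k) (\<lambda>(j, k). dilate \<psi> j k)) \<and>
     (\<forall>m<N. (\<integral>x. x ^ m * \<psi> x \<partial>lborel) = 0)"

text \<open>The left (right) prototypes live on the half-line \<open>[0,\<infinity>)\<close> (\<open>(-\<infinity>,0]\<close>) and are placed at the
  end point \<open>0\<close> (\<open>1\<close>) of the unit interval.\<close>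

record cdv_data =
  scal :: "real \<Rightarrow> real"
  wav :: "real \<Rightarrow> real"
  scal_left :: "(real \<Rightarrow> real) list"
  scal_right :: "(real \<Rightarrow> real) list"
  wav_left :: "(real \<Rightarrow> real) list"
  wav_right :: "(real \<Rightarrow> real) list"
  base_level :: nat

datatype bindex = LeftB nat | Inner int | RightB nat

fun interval_fun :: "(real \<Rightarrow> real) \<Rightarrow> (real \<Rightarrow> real) list \<Rightarrow> (real \<Rightarrow> real) list \<Rightarrow>
    nat \<Rightarrow> bindex \<Rightarrow> real \<Rightarrow> real" where
  "interval_fun \<eta> L R j (Inner k) x = dilate \<eta> j k x"
| "interval_fun \<eta> L R j (LeftB m) x = 2 powr (real j / 2) * (L ! m) (2 ^ j * x)"
| "interval_fun \<eta> L R j (RightB m) x = 2 powr (real j / 2) * (R ! m) (2 ^ j * (x - 1))"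

definition interval_idx :: "(real \<Rightarrow> real) \<Rightarrow> (real \<Rightarrow> real) list \<Rightarrow> (real \<Rightarrow> real) list \<Rightarrow>
    nat \<Rightarrow> bindex set" where
  "interval_idx \<eta> L R j =
     Inner ` {k. fsupp (dilate \<eta> j k) \<subseteq> {0<..<1}} \<union>
     LeftB ` {..<length L} \<union> RightB ` {..<length R}"

definition scal_idx :: "cdv_data \<Rightarrow> nat \<Rightarrow> bindex set" where
  "scal_idx W = interval_idx (scal W) (scal_left W) (scal_right W)"

definition scal_fun :: "cdv_data \<Rightarrow> nat \<Rightarrow> bindex \<Rightarrow> real \<Rightarrow> real" where
  "scal_fun W = interval_fun (scal W) (scal_left W) (scal_right W)"

definition wav_idx :: "cdv_data \<Rightarrow> nat \<Rightarrow> bindex set" where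
  "wav_idx W = interval_idx (wav W) (wav_left W) (wav_right W)"

definition wav_fun :: "cdv_data \<Rightarrow> nat \<Rightarrow> bindex \<Rightarrow> real \<Rightarrow> real" where
  "wav_fun W = interval_fun (wav W) (wav_left W) (wav_right W)"

abbreviation unit_interval :: "real measure" where
  "unit_interval \<equiv> restrict_space lborel {0..1}"

definition V_int :: "cdv_data \<Rightarrow> nat \<Rightarrow> (real \<Rightarrow> real) set" where
  "V_int W j = l2_span unit_interval (scal_fun W j ` scal_idx W j)"

definition W_int :: "cdv_data \<Rightarrow> nat \<Rightarrow> (real \<Rightarrow> real) set" where
  "W_int W j = l2_span unit_interval (wav_fun W j ` wav_idx W j)"

text \<open>\<open>b\<close> is the restriction to the half-line \<open>H\<close> of a finite linear combination of the functions
  \<open>\<phi>(q x - k)\<close>.  In the construction of Cohen, Daubechies and Vial the edge scaling functions arise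
  in this way with \<open>q = 1\<close>, and the edge wavelets, which belong to the next finer level, with
  \<open>q = 2\<close>.\<close>

definition edge_prototype :: "(real \<Rightarrow> real) \<Rightarrow> real \<Rightarrow> real set \<Rightarrow> (real \<Rightarrow> real) \<Rightarrow> bool" where
  "edge_prototype \<phi> q H b \<longleftrightarrow> compact (fsupp b) \<and>
     (\<exists>K c. finite K \<and>
        (\<forall>x. b x = (if x \<in> H then \<Sum>k\<in>K. c k * \<phi> (q * x - of_int (k::int)) else 0)))"

definition cdv_system :: "nat \<Rightarrow> real \<Rightarrow> cdv_data \<Rightarrow> bool" where
  "cdv_system N R W \<longleftrightarrow>
     daubechies_system N R (scal W) (wav W) \<and>
     (\<forall>b\<in>set (scal_left W). edge_prototype (scal W) 1 {0..} b) \<and>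
     (\<forall>b\<in>set (scal_right W). edge_prototype (scal W) 1 {..0} b) \<and>
     (\<forall>b\<in>set (wav_left W). edge_prototype (scal W) 2 {0..} b) \<and>
     (\<forall>b\<in>set (wav_right W). edge_prototype (scal W) 2 {..0} b) \<and>
     (\<forall>j\<ge>base_level W.
        card (scal_idx W j) = 2 ^ j \<and> card (wav_idx W j) = 2 ^ j \<and>
        l2_orthonormal unit_interval (scal_idx W j) (scal_fun W j) \<and>
        l2_orthonormal unit_interval (wav_idx W j) (wav_fun W j) \<and>
        (\<forall>f \<in> {scal_fun W j (LeftB m) |m. LeftB m \<in> scal_idx W j} \<union>
               {wav_fun W j (LeftB m) |m. LeftB m \<in> wav_idx W j}.
         \<forall>g \<in> {scal_fun W j (RightB m) |m. RightB m \<in> scal_idx W j} \<union>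
               {wav_fun W j (RightB m) |m. RightB m \<in> wav_idx W j}.
           fsupp f \<inter> fsupp g = {}) \<and>
        l2_orth_sum unit_interval (V_int W (Suc j)) (V_int W j) (W_int W j) \<and>
        (\<forall>p. degree p \<le> N - 1 \<longrightarrow> poly p \<in> V_int W j)) \<and>
     l2_onb unit_interval
       (scal_idx W (base_level W) <+> (SIGMA j:{base_level W..}. wav_idx W j))
       (case_sum (scal_fun W (base_level W)) (\<lambda>(j, k). wav_fun W j k))"

abbreviation unit_cube :: "(real ^ 'd) measure" where
  "unit_cube \<equiv> restrict_space lborel (cbox 0 1)"

definition scal_tensor :: "cdv_data \<Rightarrow> nat \<Rightarrow> ('d \<Rightarrow> bindex) \<Rightarrow> real ^ 'd \<Rightarrow> real" where
  "scal_tensor W j \<kappa> x = (\<Prod>l\<in>UNIV. scal_fun W j (\<kappa> l) (x $ l))"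

definition V_cube :: "cdv_data \<Rightarrow> nat \<Rightarrow> (real ^ 'd \<Rightarrow> real) set" where
  "V_cube W j = l2_span unit_cube (scal_tensor W j ` {\<kappa>. \<forall>l. \<kappa> l \<in> scal_idx W j})"

definition P_proj :: "cdv_data \<Rightarrow> nat \<Rightarrow> (real ^ 'd \<Rightarrow> real) \<Rightarrow> real ^ 'd \<Rightarrow> real" where
  "P_proj W j = l2_proj unit_cube (V_cube W j)"

definition Q_proj :: "cdv_data \<Rightarrow> nat \<Rightarrow> (real ^ 'd \<Rightarrow> real) \<Rightarrow> real ^ 'd \<Rightarrow> real" where
  "Q_proj W j h x = P_proj W (Suc j) h x - P_proj W j h x"

definition besov_norm :: "cdv_data \<Rightarrow> real \<Rightarrow> (real ^ 'd \<Rightarrow> real) \<Rightarrow> ennreal" where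
  "besov_norm W u h =
     ennreal (2 powr (real (base_level W) * u) * l2_norm unit_cube (P_proj W (base_level W) h)) +
     (SUP j\<in>{base_level W..}. ennreal (2 powr (real j * u) * l2_norm unit_cube (Q_proj W j h)))"

definition besov_ball :: "cdv_data \<Rightarrow> real \<Rightarrow> real \<Rightarrow> (real ^ 'd \<Rightarrow> real) set" where
  "besov_ball W u M = {h \<in> l2_set unit_cube. besov_norm W u h \<le> ennreal M}"

definition regression_class :: "cdv_data \<Rightarrow> real \<Rightarrow> real \<Rightarrow> (real ^ 'd \<Rightarrow> real) set" where
  "regression_class W u M =
     {f \<in> besov_ball W u M. AE x in unit_cube. 0 \<le> f x \<and> f x \<le> 1}"

abbreviation obs_space :: "((real ^ 'd) \<times> bool) measure" where
  "obs_space \<equiv> restrict_space borel (cbox 0 1) \<Otimes>\<^sub>M count_space UNIV"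

definition pair_law ::
    "(real ^ 'd \<Rightarrow> real) \<Rightarrow> (real ^ 'd \<Rightarrow> real) \<Rightarrow> ((real ^ 'd) \<times> bool) measure" where
  "pair_law f g = density unit_cube (\<lambda>x. ennreal (g x)) \<bind>
     (\<lambda>x. distr (measure_pmf (bernoulli_pmf (f x))) obs_space (\<lambda>y. (x, y)))"

definition sample_law :: "nat \<Rightarrow> (real ^ 'd \<Rightarrow> real) \<Rightarrow> (real ^ 'd \<Rightarrow> real) \<Rightarrow>
    (nat \<Rightarrow> (real ^ 'd) \<times> bool) measure" where
  "sample_law n f g = (\<Pi>\<^sub>M i\<in>{..<n}. pair_law f g)"

definition tests :: "nat \<Rightarrow> ((nat \<Rightarrow> (real ^ 'd) \<times> bool) \<Rightarrow> nat) set" where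
  "tests n = measurable (\<Pi>\<^sub>M i\<in>{..<n}. obs_space) (count_space {0, 1})"

definition testing_rate :: "nat \<Rightarrow> real \<Rightarrow> nat \<Rightarrow> real" where
  "testing_rate d s n = real n powr (- 2 * s / (4 * s + real d))"

end

theory Submission
  imports Defs "HOL-Real_Asymp.Real_Asymp"
begin

text \<open>The null function is a constant \<open>c \<in> (0, 1/2]\<close>, so small that its Besov norm is at most \<open>M / 2\<close> for
every smoothness below \<open>S\<close>; it lies in every multiresolution space because constants are polynomials.
The alternatives are \<open>c\<close> plus a random sign combination of tensor wavelets of one resolution level \<open>j\<close>.

Such a perturbation lies in a single detail space \<open>V\<^sub>j\<^sub>+\<^sub>1 \<ominus> V\<^sub>j\<close>, so its Besov norm is just
\<open>2\<^sup>j\<^sup>r\<close> times its \<open>L\<^sup>2\<close> norm.  Choosing the \<open>L\<^sup>2\<close> norm to be \<open>(M / 2) 2\<^sup>-\<^sup>j\<^sup>r\<close> keeps the alternative in the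
smoothness class of order \<open>r\<close> (\<open>besov_norm_const_plus_detail\<close>).  A function in the ball of order \<open>t\<close> has a
level-\<open>j\<close> detail of norm at most \<open>M 2\<^sup>-\<^sup>j\<^sup>t\<close>, which is of smaller order because \<open>t > r\<close>; hence the alternative
is at distance of order \<open>2\<^sup>-\<^sup>j\<^sup>r\<close> from that ball (\<open>l2_dist_besov_ball_ge\<close>).  Using interior
wavelets with disjoint supports makes the sup norm of the perturbation of order \<open>2\<^sup>-\<^sup>j\<^sup>r\<close> as well, so the
values stay in \<open>[0, 1]\<close> once \<open>j\<close> is large (\<open>separated_interior_wavelets\<close>).

For the testing error, the likelihood ratios of two alternatives \<open>c + h\<close> and \<open>c + h'\<close> against \<open>c\<close> have
inner product \<open>1 + \<langle>h, h'\<rangle> / (c (1 - c))\<close> for one observation.  Averaging the \<open>n\<close>-th power over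
independent signs bounds the second moment of the mixture likelihood ratio by
\<open>exp (C n\<^sup>2 2 powr (- j (4 r + d)))\<close>, and the sum of the two errors of any test is at least
\<open>1 - sqrt (m - 1)\<close> where \<open>m\<close> is this second moment (\<open>ingster_lower_bound\<close>).  Taking \<open>j\<close> with
\<open>2\<^sup>j\<close> a large fixed multiple of \<open>n powr (2 / (4 r + d))\<close> makes the second moment as close to one as desired,
while the separation \<open>2\<^sup>-\<^sup>j\<^sup>r\<close> is still a fixed multiple of the testing rate and so dominates \<open>\<delta>\<close>
(\<open>resolution_level_exists\<close>).  The upper bound one is attained by the test that always rejects.\<close>

section \<open>Inner products, spans and projections in \<open>L\<^sup>2\<close>\<close>

lemma l2_mult_integrable:
  assumes "f \<in> l2_set M" "g \<in> l2_set M"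
  shows "integrable M (\<lambda>x. f x * g x)"
proof (rule Bochner_Integration.integrable_bound)
  show "integrable M (\<lambda>x. (f x)\<^sup>2 + (g x)\<^sup>2)" using assms by (simp add: l2_set_def)
  show "(\<lambda>x. f x * g x) \<in> borel_measurable M" using assms by (auto simp: l2_set_def)
  have "\<bar>a * b\<bar> \<le> \<bar>a\<^sup>2 + b\<^sup>2\<bar>" for a b :: real
    using sum_squares_bound[of "\<bar>a\<bar>" "\<bar>b\<bar>"] mult_nonneg_nonneg[OF abs_ge_zero abs_ge_zero, of a b]
    unfolding abs_mult power2_abs by linarith
  then show "AE x in M. norm (f x * g x) \<le> norm ((f x)\<^sup>2 + (g x)\<^sup>2)" by simp
qed

lemma l2_set_zero: "(\<lambda>x. 0) \<in> l2_set M"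
  by (simp add: l2_set_def)

lemma l2_set_scale: "f \<in> l2_set M \<Longrightarrow> (\<lambda>x. a * f x) \<in> l2_set M"
  by (auto simp: l2_set_def power_mult_distrib)

lemma l2_set_add:
  assumes "f \<in> l2_set M" "g \<in> l2_set M"
  shows "(\<lambda>x. f x + g x) \<in> l2_set M"
  using assms l2_mult_integrable[OF assms] by (auto simp: l2_set_def power2_sum mult.assoc)

lemma l2_set_diff:
  assumes "f \<in> l2_set M" "g \<in> l2_set M"
  shows "(\<lambda>x. f x - g x) \<in> l2_set M"
  using l2_set_add[OF assms(1) l2_set_scale[OF assms(2), of "-1"]] by simp

lemma l2_set_lincomb:
  assumes "\<And>i. i \<in> I \<Longrightarrow> F i \<in> l2_set M"
  shows "(\<lambda>x. \<Sum>i\<in>I. a i * F i x) \<in> l2_set M"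
  using assms
  by (induction I rule: infinite_finite_induct) (auto intro!: l2_set_zero l2_set_add l2_set_scale)

lemma l2_inner_commute: "l2_inner M f g = l2_inner M g f"
  by (simp add: l2_inner_def mult.commute)

lemma l2_inner_cong_AE:
  assumes "AE x in M. f x = f' x" "f \<in> l2_set M" "f' \<in> l2_set M" "g \<in> l2_set M"
  shows "l2_inner M f g = l2_inner M f' g"
  unfolding l2_inner_def
  using assms by (intro integral_cong_AE) (auto simp: l2_set_def elim: AE_mp)

lemma l2_inner_add_left:
  assumes "f \<in> l2_set M" "f' \<in> l2_set M" "g \<in> l2_set M"
  shows "l2_inner M (\<lambda>x. f x + f' x) g = l2_inner M f g + l2_inner M f' g"
  using l2_mult_integrable[OF assms(1,3)] l2_mult_integrable[OF assms(2,3)]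
  by (simp add: l2_inner_def distrib_right)

lemma l2_inner_diff_left:
  assumes "f \<in> l2_set M" "f' \<in> l2_set M" "g \<in> l2_set M"
  shows "l2_inner M (\<lambda>x. f x - f' x) g = l2_inner M f g - l2_inner M f' g"
  using l2_mult_integrable[OF assms(1,3)] l2_mult_integrable[OF assms(2,3)]
  by (simp add: l2_inner_def left_diff_distrib)

lemma l2_inner_scale_left: "l2_inner M (\<lambda>x. a * f x) g = a * l2_inner M f g"
  by (simp add: l2_inner_def mult.assoc)

lemma l2_inner_lincomb_left:
  assumes "\<And>i. i \<in> I \<Longrightarrow> F i \<in> l2_set M" "g \<in> l2_set M"
  shows "l2_inner M (\<lambda>x. \<Sum>i\<in>I. a i * F i x) g = (\<Sum>i\<in>I. a i * l2_inner M (F i) g)"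
  using l2_mult_integrable[OF assms(1,2)]
  by (simp add: l2_inner_def sum_distrib_right mult.assoc Bochner_Integration.integral_sum)

lemma l2_inner_orthonormal_sums:
  assumes F: "l2_orthonormal M I F" and I: "finite I"
  shows "l2_inner M (\<lambda>x. \<Sum>i\<in>I. a i * F i x) (\<lambda>x. \<Sum>i\<in>I. b i * F i x) = (\<Sum>i\<in>I. a i * b i)"
proof -
  have mem: "\<And>i. i \<in> I \<Longrightarrow> F i \<in> l2_set M" using F by (simp add: l2_orthonormal_def)
  have "l2_inner M (\<lambda>x. \<Sum>i\<in>I. a i * F i x) (\<lambda>x. \<Sum>i\<in>I. b i * F i x)
     = (\<Sum>i\<in>I. a i * (\<Sum>k\<in>I. b k * l2_inner M (F k) (F i)))"
  proof -
    have "l2_inner M (F i) (\<lambda>x. \<Sum>k\<in>I. b k * F k x) = (\<Sum>k\<in>I. b k * l2_inner M (F k) (F i))" if "i \<in> I" for i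
      using mem that by (subst l2_inner_commute) (rule l2_inner_lincomb_left)
    then show ?thesis using mem by (simp add: l2_inner_lincomb_left l2_set_lincomb)
  qed
  also have "\<dots> = (\<Sum>i\<in>I. a i * b i)"
    using F I by (intro sum.cong refl) (auto simp: l2_orthonormal_def if_distrib[where f="\<lambda>z. _ * z"] cong: if_cong)
  finally show ?thesis .
qed

lemma l2_norm_power2: "(l2_norm M f)\<^sup>2 = l2_inner M f f"
  unfolding l2_norm_def l2_inner_def by (simp add: power2_eq_square)

lemma l2_norm_nonneg: "0 \<le> l2_norm M f"
  by (simp add: l2_norm_def)

lemma l2_cauchy_schwarz:
  assumes f: "f \<in> l2_set M" and g: "g \<in> l2_set M"
  shows "\<bar>l2_inner M f g\<bar> \<le> l2_norm M f * l2_norm M g"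
proof -
  let ?p = "l2_inner M f g" and ?F = "l2_inner M f f" and ?G = "l2_inner M g g"
  have quad: "0 \<le> ?F - 2 * t * ?p + t\<^sup>2 * ?G" for t
  proof -
    have m: "(\<lambda>x. f x - t * g x) \<in> l2_set M" using f g by (intro l2_set_diff l2_set_scale)
    have "0 \<le> l2_inner M (\<lambda>x. f x - t * g x) (\<lambda>x. f x - t * g x)"
      by (simp add: l2_inner_def)
    also have "\<dots> = l2_inner M f (\<lambda>x. f x - t * g x) - t * l2_inner M g (\<lambda>x. f x - t * g x)"
      using f g m by (simp add: l2_inner_diff_left l2_inner_scale_left l2_set_scale)
    also have "l2_inner M f (\<lambda>x. f x - t * g x) = ?F - t * ?p"
      using f g by (subst l2_inner_commute)
        (simp add: l2_inner_diff_left l2_inner_scale_left l2_set_scale l2_inner_commute[of M g f])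
    also have "l2_inner M g (\<lambda>x. f x - t * g x) = ?p - t * ?G"
      using f g by (subst l2_inner_commute)
        (simp add: l2_inner_diff_left l2_inner_scale_left l2_set_scale)
    also have "?F - t * ?p - t * (?p - t * ?G) = ?F - 2 * t * ?p + t\<^sup>2 * ?G"
      by (simp add: power2_eq_square algebra_simps)
    finally show ?thesis .
  qed
  have "?p\<^sup>2 \<le> ?F * ?G"
  proof (cases "?G = 0")
    case True
    have "?p = 0"
    proof (rule ccontr)
      assume p: "?p \<noteq> 0"
      show False using quad[of "(?F + 1) / (2 * ?p)"] p True by simp
    qed
    then show ?thesis using True by simp
  next
    case False
    then have G: "?G > 0" using l2_norm_power2[of M g] by (metis zero_le_power2 order_le_less)
    have "0 \<le> ?F - ?p\<^sup>2 / ?G"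
      using quad[of "?p / ?G"] G by (simp add: power2_eq_square field_simps)
    then show ?thesis using G by (simp add: field_simps)
  qed
  also have "\<dots> = (l2_norm M f * l2_norm M g)\<^sup>2"
    by (simp add: power_mult_distrib l2_norm_power2)
  finally show ?thesis
    by (subst (asm) power2_abs[symmetric]) (rule power2_le_imp_le, simp_all add: l2_norm_nonneg)
qed

lemma l2_norm_cong_AE:
  assumes "AE x in M. f x = g x" "f \<in> l2_set M" "g \<in> l2_set M"
  shows "l2_norm M f = l2_norm M g"
  unfolding l2_norm_def using assms
  by (intro arg_cong[where f=sqrt] integral_cong_AE) (auto simp: l2_set_def)

lemma l2_span_subset: "l2_span M B \<subseteq> l2_set M"
  by (auto simp: l2_span_def)

lemma l2_span_base:
  assumes "b \<in> B" "b \<in> l2_set M" shows "b \<in> l2_span M B"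
  using assms unfolding l2_span_def
  by (auto intro!: exI[of _ "{b}"] exI[of _ "\<lambda>_. 1"])

lemma l2_span_cong_AE:
  assumes "h \<in> l2_set M" "v \<in> l2_span M B" "AE x in M. h x = v x"
  shows "h \<in> l2_span M B"
proof -
  obtain F c where F: "finite F" "F \<subseteq> B" "AE x in M. v x = (\<Sum>b\<in>F. c b * b x)"
    using assms(2) by (auto simp: l2_span_def)
  from assms(3) F(3) have "AE x in M. h x = (\<Sum>b\<in>F. c b * b x)" by eventually_elim simp
  with F assms(1) show ?thesis by (auto simp: l2_span_def)
qed

lemma l2_span_zero: "(\<lambda>x. 0) \<in> l2_span M B"
  by (auto simp: l2_span_def l2_set_zero intro!: exI[of _ "{}"])

lemma l2_span_scale:
  assumes "f \<in> l2_span M B" shows "(\<lambda>x. a * f x) \<in> l2_span M B"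
proof -
  obtain F c where F: "finite F" "F \<subseteq> B" "AE x in M. f x = (\<Sum>b\<in>F. c b * b x)"
    using assms by (auto simp: l2_span_def)
  from F(3) have "AE x in M. a * f x = (\<Sum>b\<in>F. (a * c b) * b x)"
    by eventually_elim (simp add: sum_distrib_left mult.assoc)
  with F assms show ?thesis
    by (auto simp: l2_span_def intro!: l2_set_scale exI[of _ F] exI[of _ "\<lambda>b. a * c b"])
qed

lemma l2_span_add:
  assumes "f \<in> l2_span M B" "g \<in> l2_span M B" shows "(\<lambda>x. f x + g x) \<in> l2_span M B"
proof -
  obtain F c where F: "finite F" "F \<subseteq> B" "AE x in M. f x = (\<Sum>b\<in>F. c b * b x)"
    using assms(1) by (auto simp: l2_span_def)
  obtain G d where G: "finite G" "G \<subseteq> B" "AE x in M. g x = (\<Sum>b\<in>G. d b * b x)"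
    using assms(2) by (auto simp: l2_span_def)
  define k where "k b = (if b \<in> F then c b else 0) + (if b \<in> G then d b else 0)" for b
  from F(3) G(3) have "AE x in M. f x + g x = (\<Sum>b\<in>F \<union> G. k b * b x)"
  proof eventually_elim
    fix x assume "f x = (\<Sum>b\<in>F. c b * b x)" "g x = (\<Sum>b\<in>G. d b * b x)"
    moreover have "(\<Sum>b\<in>F. c b * b x) = (\<Sum>b\<in>F \<union> G. (if b \<in> F then c b else 0) * b x)"
      using F(1) G(1) by (intro sum.mono_neutral_cong_left) auto
    moreover have "(\<Sum>b\<in>G. d b * b x) = (\<Sum>b\<in>F \<union> G. (if b \<in> G then d b else 0) * b x)"
      using F(1) G(1) by (intro sum.mono_neutral_cong_left) auto
    ultimately show "f x + g x = (\<Sum>b\<in>F \<union> G. k b * b x)"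
      by (simp add: k_def distrib_right sum.distrib)
  qed
  moreover have "(\<lambda>x. f x + g x) \<in> l2_set M"
    using assms by (intro l2_set_add) (auto simp: l2_span_def)
  ultimately show ?thesis using F G
    by (auto simp: l2_span_def intro!: exI[of _ "F \<union> G"] exI[of _ k])
qed

lemma l2_span_diff:
  assumes "f \<in> l2_span M B" "g \<in> l2_span M B" shows "(\<lambda>x. f x - g x) \<in> l2_span M B"
  using l2_span_add[OF assms(1) l2_span_scale[OF assms(2), of "-1"]] by simp

lemma l2_span_lincomb:
  assumes "\<And>i. i \<in> I \<Longrightarrow> F i \<in> l2_span M B"
  shows "(\<lambda>x. \<Sum>i\<in>I. a i * F i x) \<in> l2_span M B"
  using assms
  by (induction I rule: infinite_finite_induct) (auto intro!: l2_span_zero l2_span_add l2_span_scale)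

lemma l2_span_subset_span:
  assumes "B \<subseteq> l2_span M B'" shows "l2_span M B \<subseteq> l2_span M B'"
proof
  fix h assume h: "h \<in> l2_span M B"
  then obtain F c where F: "finite F" "F \<subseteq> B" "AE x in M. h x = (\<Sum>b\<in>F. c b * b x)"
    by (auto simp: l2_span_def)
  have "(\<lambda>x. \<Sum>b\<in>F. c b * b x) \<in> l2_span M B'"
    using F assms by (intro l2_span_lincomb) auto
  from l2_span_cong_AE[OF _ this F(3)] h show "h \<in> l2_span M B'" by (auto simp: l2_span_def)
qed

lemma l2_inner_span_zero:
  assumes h: "h \<in> l2_set M" and B: "B \<subseteq> l2_set M" "\<And>b. b \<in> B \<Longrightarrow> l2_inner M h b = 0"
    and v: "v \<in> l2_span M B"
  shows "l2_inner M h v = 0"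
proof -
  obtain F c where F: "finite F" "F \<subseteq> B" "AE x in M. v x = (\<Sum>b\<in>F. c b * b x)"
    using v by (auto simp: l2_span_def)
  have "l2_inner M v h = l2_inner M (\<lambda>x. \<Sum>b\<in>F. c b * b x) h"
    using F B v h by (intro l2_inner_cong_AE l2_set_lincomb) (auto simp: l2_span_def)
  also have "\<dots> = (\<Sum>b\<in>F. c b * l2_inner M b h)"
    using F B h by (intro l2_inner_lincomb_left) auto
  also have "\<dots> = 0"
    using F B by (intro sum.neutral) (auto simp: l2_inner_commute[of M _ h])
  finally show ?thesis by (simp add: l2_inner_commute)
qed

lemma l2_inner_self_zero_AE:
  assumes "h \<in> l2_set M" "l2_inner M h h = 0" shows "AE x in M. h x = 0"
proof -
  have "AE x in M. (h x)\<^sup>2 = 0"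
    using assms by (subst integral_nonneg_eq_0_iff_AE[symmetric])
      (auto simp: l2_set_def l2_inner_def power2_eq_square)
  then show ?thesis by simp
qed

text \<open>The projection is defined by choice, so all that can be known about it is its defining property.  This
identifies it with any explicit candidate, up to null sets.\<close>

lemma l2_proj_AE_unique:
  assumes V: "V = l2_span M B" and h: "h \<in> l2_set M" and p: "p \<in> V"
    and orth: "\<And>v. v \<in> V \<Longrightarrow> l2_inner M (\<lambda>x. h x - p x) v = 0"
  shows "AE x in M. l2_proj M V h x = p x"
proof -
  define q where "q = l2_proj M V h"
  have "q \<in> V \<and> (\<forall>v\<in>V. l2_inner M (\<lambda>x. h x - q x) v = 0)"
    unfolding q_def l2_proj_def by (rule someI[of _ p]) (use p orth in auto)
  then have q: "q \<in> V" "\<And>v. v \<in> V \<Longrightarrow> l2_inner M (\<lambda>x. h x - q x) v = 0" by auto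
  have ml: "p \<in> l2_set M" "q \<in> l2_set M" using p q V by (auto simp: l2_span_def)
  have d: "(\<lambda>x. q x - p x) \<in> V" using p q unfolding V by (intro l2_span_diff)
  have dl: "(\<lambda>x. q x - p x) \<in> l2_set M" using ml by (intro l2_set_diff) 
  have "l2_inner M (\<lambda>x. q x - p x) (\<lambda>x. q x - p x) =
     l2_inner M (\<lambda>x. (h x - p x) - (h x - q x)) (\<lambda>x. q x - p x)" by simp
  also have "\<dots> = 0"
    using orth[OF d] q(2)[OF d] h ml dl by (subst l2_inner_diff_left) (auto intro!: l2_set_diff)
  finally show ?thesis using l2_inner_self_zero_AE[OF dl] unfolding q_def by simp
qed

text \<open>The Fourier sum witnesses that a projection exists; without a witness the chosen function would be arbitrary.\<close>

lemma l2_proj_orthonormal: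
  assumes F: "l2_orthonormal M I F" and I: "finite I" and h: "h \<in> l2_set M"
  defines "V \<equiv> l2_span M (F ` I)"
  shows "l2_proj M V h \<in> V" "v \<in> V \<Longrightarrow> l2_inner M (\<lambda>x. h x - l2_proj M V h x) v = 0"
proof -
  have mem: "\<And>i. i \<in> I \<Longrightarrow> F i \<in> l2_set M" using F by (simp add: l2_orthonormal_def)
  define p where "p x = (\<Sum>i\<in>I. l2_inner M h (F i) * F i x)" for x
  have p: "p \<in> V" unfolding p_def V_def
    by (intro l2_span_lincomb l2_span_base) (auto simp: mem)
  then have pl: "p \<in> l2_set M" by (auto simp: V_def l2_span_def)
  have orth: "l2_inner M (\<lambda>x. h x - p x) v = 0" if "v \<in> V" for v
  proof (rule l2_inner_span_zero[OF _ _ _ that[unfolded V_def]])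
    show "(\<lambda>x. h x - p x) \<in> l2_set M" using h pl by (rule l2_set_diff)
    show "F ` I \<subseteq> l2_set M" using mem by auto
    fix b assume "b \<in> F ` I"
    then obtain k where k: "k \<in> I" "b = F k" by auto
    have "l2_inner M p (F k) = (\<Sum>i\<in>I. l2_inner M h (F i) * l2_inner M (F i) (F k))"
      unfolding p_def using mem k by (intro l2_inner_lincomb_left) auto
    also have "\<dots> = l2_inner M h (F k)"
      using F I k by (simp add: l2_orthonormal_def if_distrib[where f="\<lambda>z. _ * z"] cong: if_cong)
    finally show "l2_inner M (\<lambda>x. h x - p x) b = 0"
      using h pl mem k by (simp add: l2_inner_diff_left)
  qed
  have *: "l2_proj M V h \<in> V \<and> (\<forall>v\<in>V. l2_inner M (\<lambda>x. h x - l2_proj M V h x) v = 0)"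
    unfolding l2_proj_def by (rule someI[of _ p]) (use p orth in auto)
  then show "l2_proj M V h \<in> V" "v \<in> V \<Longrightarrow> l2_inner M (\<lambda>x. h x - l2_proj M V h x) v = 0" by auto
qed

section \<open>Tensor products on the unit cube\<close>

lemma prob_space_unit_cube: "prob_space (unit_cube :: (real^'d) measure)"
proof
  have "emeasure (unit_cube :: (real^'d) measure) (space unit_cube) = emeasure lborel (cbox 0 (1::real^'d))"
    by (simp add: emeasure_restrict_space space_restrict_space)
  also have "\<dots> = 1"
  proof -
    have "b \<in> Basis \<Longrightarrow> (1::real^'d) \<bullet> b = 1" for b by (auto simp: Basis_vec_def inner_axis)
    then show ?thesis by (simp add: emeasure_lborel_cbox_eq)
  qed
  finally show "emeasure (unit_cube :: (real^'d) measure) (space unit_cube) = 1" .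
qed

lemma measurable_vec_lambda: "vec_lambda \<in> (\<Pi>\<^sub>M i\<in>(UNIV::'d::finite set). lborel) \<rightarrow>\<^sub>M (borel :: (real^'d) measure)"
  by (subst borel_measurable_euclidean_space) (auto simp: Basis_vec_def inner_axis)

text \<open>Products of functions of single coordinates are integrated by Fubini's theorem for products indexed by a finite
type; this transfers that theorem to vectors.\<close>

lemma lborel_vec: "(lborel :: (real^'d) measure) = distr (\<Pi>\<^sub>M i\<in>(UNIV::'d::finite set). lborel) borel vec_lambda"
proof (rule lborel_eqI)
  interpret product_sigma_finite "\<lambda>_::'d. lborel :: real measure" by standard
  fix l u :: "real^'d" assume le: "\<And>b. b \<in> Basis \<Longrightarrow> l \<bullet> b \<le> u \<bullet> b"
  have le': "l $ i \<le> u $ i" for i using le[of "axis i 1"] by (simp add: inner_axis axis_in_Basis_iff)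
  have "emeasure (distr (\<Pi>\<^sub>M i\<in>(UNIV::'d::finite set). lborel) borel vec_lambda) (box l u)
    = emeasure (\<Pi>\<^sub>M i\<in>(UNIV::'d::finite set). lborel) (Pi\<^sub>E UNIV (\<lambda>i. {l $ i<..<u $ i}))"
    by (subst emeasure_distr[OF measurable_vec_lambda])
      (auto simp: space_PiM mem_box_cart PiE_iff extensional_def intro!: arg_cong[where f="emeasure _"])
  also have "\<dots> = (\<Prod>i\<in>UNIV. ennreal (u $ i - l $ i))"
    using le' by (subst emeasure_PiM) auto
  also have "\<dots> = ennreal (\<Prod>i\<in>UNIV. u $ i - l $ i)"
    using le' by (intro prod_ennreal) auto
  also have "(\<Prod>i\<in>UNIV. u $ i - l $ i) = (\<Prod>b\<in>Basis. (u - l) \<bullet> b)"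
  proof -
    have B: "(Basis :: (real^'d) set) = range (\<lambda>i. axis i 1)" by (auto simp: Basis_vec_def)
    have "inj (\<lambda>i::'d. axis i (1::real))" by (auto simp: inj_def axis_eq_axis)
    then show ?thesis unfolding B by (subst prod.reindex) (auto simp: inner_axis)
  qed
  finally show "emeasure (distr (\<Pi>\<^sub>M i\<in>(UNIV::'d::finite set). lborel) borel vec_lambda) (box l u)
     = ennreal (\<Prod>b\<in>Basis. (u - l) \<bullet> b)" by simp
qed simp

lemma measurable_component_unit_cube:
  "(\<lambda>x::real^'d. x $ l) \<in> unit_cube \<rightarrow>\<^sub>M unit_interval"
  by (rule measurable_restrict_space3) (auto simp: mem_box_cart)

lemma nn_integral_unit_cube_prod:
  fixes u :: "'d::finite \<Rightarrow> real \<Rightarrow> ennreal"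
  assumes u: "\<And>l. u l \<in> borel_measurable unit_interval"
  shows "(\<integral>\<^sup>+x. (\<Prod>l\<in>UNIV. u l (x $ l)) \<partial>unit_cube) = (\<Prod>l\<in>UNIV. \<integral>\<^sup>+y. u l y \<partial>unit_interval)"
proof -
  interpret product_sigma_finite "\<lambda>_::'d. lborel :: real measure" by standard
  have m: "(\<lambda>y. u l y * indicator {0..1} y) \<in> borel_measurable lborel" for l
    using u[of l] by (subst (asm) borel_measurable_restrict_space_iff_ennreal) auto
  have "(\<integral>\<^sup>+x. (\<Prod>l\<in>UNIV. u l (x $ l)) \<partial>unit_cube)
     = (\<integral>\<^sup>+x. (\<Prod>l\<in>UNIV. u l (x $ l)) * indicator (cbox 0 1) x \<partial>lborel)"
    by (intro nn_integral_restrict_space) auto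
  also have "\<dots> = (\<integral>\<^sup>+x. (\<Prod>l\<in>UNIV. u l (x $ l) * indicator {0..1} (x $ l)) \<partial>(lborel :: (real^'d) measure))"
  proof (intro nn_integral_cong)
    fix x :: "real^'d"
    have "indicator (cbox 0 1) x = (\<Prod>l\<in>UNIV. indicator {0..1} (x $ l) :: ennreal)"
      by (auto simp: indicator_def mem_box_cart prod_zero_iff)
    then show "(\<Prod>l\<in>UNIV. u l (x $ l)) * indicator (cbox 0 1) x
       = (\<Prod>l\<in>UNIV. u l (x $ l) * indicator {0..1} (x $ l))" by (simp add: prod.distrib)
  qed
  also have "\<dots> = (\<integral>\<^sup>+x. (\<Prod>l\<in>UNIV. u l (x l) * indicator {0..1} (x l)) \<partial>(\<Pi>\<^sub>M i\<in>(UNIV::'d set). lborel))"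
  proof -
    have "(\<lambda>x::real^'d. u l (x $ l) * indicator {0..1} (x $ l)) \<in> borel_measurable borel" for l
      by (rule measurable_compose[where g="\<lambda>y. u l y * indicator {0..1} y"]) (use m in auto)
    then have "(\<lambda>x::real^'d. \<Prod>l\<in>UNIV. u l (x $ l) * indicator {0..1} (x $ l)) \<in> borel_measurable borel"
      by auto
    then show ?thesis
      unfolding lborel_vec by (subst nn_integral_distr[OF measurable_vec_lambda]) auto
  qed
  also have "\<dots> = (\<Prod>l\<in>UNIV. \<integral>\<^sup>+y. u l y * indicator {0..1} y \<partial>lborel)"
    using m by (intro product_nn_integral_prod) auto
  also have "\<dots> = (\<Prod>l\<in>UNIV. \<integral>\<^sup>+y. u l y \<partial>unit_interval)"
    by (intro prod.cong refl nn_integral_restrict_space[symmetric]) auto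
  finally show ?thesis .
qed

lemma measurable_tensor:
  fixes u :: "'d::finite \<Rightarrow> real \<Rightarrow> real"
  assumes u: "\<And>l. u l \<in> borel_measurable unit_interval"
  shows "(\<lambda>x. \<Prod>l\<in>UNIV. u l (x $ l)) \<in> borel_measurable unit_cube"
proof -
  have "(\<lambda>x::real^'d. u l (x $ l)) \<in> borel_measurable unit_cube" for l
    by (rule measurable_compose[OF measurable_component_unit_cube u])
  then show ?thesis by auto
qed

lemma integral_unit_cube_prod:
  fixes u :: "'d::finite \<Rightarrow> real \<Rightarrow> real"
  assumes u: "\<And>l. integrable unit_interval (u l)"
  shows "integrable unit_cube (\<lambda>x. \<Prod>l\<in>UNIV. u l (x $ l))"
    and "(\<integral>x. (\<Prod>l\<in>UNIV. u l (x $ l)) \<partial>unit_cube) = (\<Prod>l\<in>UNIV. \<integral>y. u l y \<partial>unit_interval)"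
proof -
  interpret product_sigma_finite "\<lambda>_::'d. lborel :: real measure" by standard
  have i: "integrable lborel (\<lambda>y. indicator {0..1} y * u l y)" for l
    using u[of l] by (subst (asm) integrable_restrict_space) auto
  have m: "(\<lambda>x::real^'d. \<Prod>l\<in>UNIV. indicator {0..1} (x $ l) * u l (x $ l)) \<in> borel_measurable borel"
  proof -
    have "(\<lambda>x::real^'d. indicator {0..1} (x $ l) * u l (x $ l)) \<in> borel_measurable borel" for l
      by (rule measurable_compose[where g="\<lambda>y. indicator {0..1} y * u l y"])
        (use i[of l] in \<open>auto dest: borel_measurable_integrable\<close>)
    then show ?thesis by auto
  qed
  have ind: "indicator (cbox 0 1) x *\<^sub>R (\<Prod>l\<in>UNIV. u l (x $ l)) = (\<Prod>l\<in>UNIV. indicator {0..1} (x $ l) * u l (x $ l))"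
    for x :: "real^'d"
  proof -
    have "indicator (cbox 0 1) x = (\<Prod>l\<in>UNIV. indicator {0..1} (x $ l) :: real)"
      by (auto simp: indicator_def mem_box_cart prod_zero_iff)
    then show ?thesis by (simp add: prod.distrib)
  qed
  show "integrable unit_cube (\<lambda>x. \<Prod>l\<in>UNIV. u l (x $ l))"
  proof (subst integrable_restrict_space)
    have "integrable (\<Pi>\<^sub>M i\<in>(UNIV::'d set). lborel) (\<lambda>x. \<Prod>l\<in>UNIV. indicator {0..1} (x l) * u l (x l))"
      using i by (intro product_integrable_prod) auto
    then show "integrable lborel (\<lambda>x::real^'d. indicator (cbox 0 1) x *\<^sub>R (\<Prod>l\<in>UNIV. u l (x $ l)))"
      unfolding ind lborel_vec by (subst integrable_distr_eq[OF measurable_vec_lambda m]) simp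
  qed simp
  have "(\<integral>x. (\<Prod>l\<in>UNIV. u l (x $ l)) \<partial>unit_cube)
     = (\<integral>x. (\<Prod>l\<in>UNIV. indicator {0..1} (x $ l) * u l (x $ l)) \<partial>(lborel :: (real^'d) measure))"
    unfolding ind[symmetric] by (rule integral_restrict_space) auto
  also have "\<dots> = (\<integral>x. (\<Prod>l\<in>UNIV. indicator {0..1} (x l) * u l (x l)) \<partial>(\<Pi>\<^sub>M i\<in>(UNIV::'d set). lborel))"
    by (subst lborel_vec, subst integral_distr[OF measurable_vec_lambda m]) simp
  also have "\<dots> = (\<Prod>l\<in>UNIV. \<integral>y. indicator {0..1} y * u l y \<partial>lborel)"
    using i by (intro product_integral_prod) auto
  also have "\<dots> = (\<Prod>l\<in>UNIV. \<integral>y. u l y \<partial>unit_interval)"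
    by (intro prod.cong refl) (subst integral_restrict_space, auto)
  finally show "(\<integral>x. (\<Prod>l\<in>UNIV. u l (x $ l)) \<partial>unit_cube) = (\<Prod>l\<in>UNIV. \<integral>y. u l y \<partial>unit_interval)" .
qed

text \<open>Needed because the one-dimensional expansions of tensor factors hold only almost everywhere.  The
cylinder over a null set is null since its indicator is a product with one factor of integral zero.\<close>

lemma AE_unit_cube_component:
  assumes "AE y in unit_interval. P y"
  shows "AE x in (unit_cube :: (real^'d) measure). P (x $ l)"
proof -
  obtain N where N: "N \<in> null_sets unit_interval" "{y \<in> space unit_interval. \<not> P y} \<subseteq> N"
    using assms by (auto elim!: AE_E3 intro: that simp: eventually_ae_filter)
  let ?u = "\<lambda>i y. if i = l then indicator N y else 1 :: ennreal"
  have "(\<integral>\<^sup>+x. (\<Prod>i\<in>UNIV. ?u i (x $ i)) \<partial>(unit_cube :: (real^'d) measure)) = (\<Prod>i\<in>(UNIV::'d set). \<integral>\<^sup>+y. ?u i y \<partial>unit_interval)"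
    using N by (intro nn_integral_unit_cube_prod) auto
  also have "\<dots> = 0"
  proof -
    have "(\<integral>\<^sup>+y. ?u l y \<partial>unit_interval) = 0" using N by (simp add: null_sets_def)
    then show ?thesis by (intro prod_zero bexI[of _ l]) simp_all
  qed
  finally have "AE x in (unit_cube :: (real^'d) measure). (\<Prod>i\<in>UNIV. ?u i (x $ i)) = 0"
  proof (subst (asm) nn_integral_0_iff_AE)
    have "(\<lambda>x::real^'d. ?u i (x $ i)) \<in> borel_measurable unit_cube" for i
      by (rule measurable_compose[OF measurable_component_unit_cube]) (use N in auto)
    then show "(\<lambda>x::real^'d. \<Prod>i\<in>UNIV. ?u i (x $ i)) \<in> borel_measurable unit_cube"
      by (intro borel_measurable_prod_ennreal)
  qed
  then show ?thesis
  proof (rule AE_mp, intro AE_I2 impI)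
    fix x :: "real^'d" assume x: "x \<in> space unit_cube" "(\<Prod>i\<in>UNIV. ?u i (x $ i)) = 0"
    then have "x $ l \<in> space unit_interval"
      by (auto simp: space_restrict_space mem_box_cart)
    moreover have "x $ l \<notin> N" using x(2) by (auto simp: prod_zero_iff split: if_splits)
    ultimately show "P (x $ l)" using N(2) by auto
  qed
qed

lemma l2_set_tensor:
  fixes u :: "'d::finite \<Rightarrow> real \<Rightarrow> real"
  assumes u: "\<And>l. u l \<in> l2_set unit_interval"
  shows "(\<lambda>x. \<Prod>l\<in>UNIV. u l (x $ l)) \<in> l2_set unit_cube"
proof -
  have "integrable unit_cube (\<lambda>x::real^'d. \<Prod>l\<in>UNIV. (u l (x $ l))\<^sup>2)"
    by (rule integral_unit_cube_prod(1)[of "\<lambda>l y. (u l y)\<^sup>2"]) (use u in \<open>simp add: l2_set_def\<close>)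
  moreover have "(\<lambda>x::real^'d. \<Prod>l\<in>UNIV. u l (x $ l)) \<in> borel_measurable unit_cube"
    by (rule measurable_tensor) (use u in \<open>simp add: l2_set_def\<close>)
  ultimately show ?thesis by (simp add: l2_set_def prod_power_distrib)
qed

lemma l2_inner_tensor:
  fixes u v :: "'d::finite \<Rightarrow> real \<Rightarrow> real"
  assumes u: "\<And>l. u l \<in> l2_set unit_interval" and v: "\<And>l. v l \<in> l2_set unit_interval"
  shows "l2_inner unit_cube (\<lambda>x. \<Prod>l\<in>UNIV. u l (x $ l)) (\<lambda>x. \<Prod>l\<in>UNIV. v l (x $ l))
       = (\<Prod>l\<in>UNIV. l2_inner unit_interval (u l) (v l))"
  using integral_unit_cube_prod(2)[of "\<lambda>l y. u l y * v l y", OF l2_mult_integrable[OF u v]]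
  unfolding l2_inner_def prod.distrib .

lemma l2_orthonormal_tensor:
  fixes F :: "'i \<Rightarrow> real \<Rightarrow> real"
  assumes "l2_orthonormal unit_interval I F"
  shows "l2_orthonormal unit_cube {\<kappa>. \<forall>l. \<kappa> l \<in> I} (\<lambda>\<kappa> (x::real^'d). \<Prod>l\<in>UNIV. F (\<kappa> l) (x $ l))"
  unfolding l2_orthonormal_def
proof (intro conjI ballI)
  fix \<kappa> :: "'d \<Rightarrow> 'i" assume k: "\<kappa> \<in> {\<kappa>. \<forall>l. \<kappa> l \<in> I}"
  have mem: "i \<in> I \<Longrightarrow> F i \<in> l2_set unit_interval" for i using assms by (auto simp: l2_orthonormal_def)
  show "(\<lambda>x::real^'d. \<Prod>l\<in>UNIV. F (\<kappa> l) (x $ l)) \<in> l2_set unit_cube"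
    using k mem by (intro l2_set_tensor) auto
  fix \<kappa>' :: "'d \<Rightarrow> 'i" assume k': "\<kappa>' \<in> {\<kappa>. \<forall>l. \<kappa> l \<in> I}"
  have "l2_inner unit_cube (\<lambda>x::real^'d. \<Prod>l\<in>UNIV. F (\<kappa> l) (x $ l)) (\<lambda>x. \<Prod>l\<in>UNIV. F (\<kappa>' l) (x $ l))
     = (\<Prod>l\<in>UNIV. l2_inner unit_interval (F (\<kappa> l)) (F (\<kappa>' l)))"
    using k k' mem by (intro l2_inner_tensor) auto
  also have "\<dots> = (\<Prod>l\<in>UNIV. if \<kappa> l = \<kappa>' l then 1 else 0)"
    using k k' assms by (intro prod.cong refl) (auto simp: l2_orthonormal_def)
  also have "\<dots> = (if \<kappa> = \<kappa>' then 1 else 0)"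
  proof (cases "\<kappa> = \<kappa>'")
    case False
    then obtain l where "\<kappa> l \<noteq> \<kappa>' l" by auto
    then have "(\<Prod>l\<in>UNIV. if \<kappa> l = \<kappa>' l then 1 else 0 :: real) = 0" by (intro prod_zero bexI[of _ l]) auto
    then show ?thesis using False by simp
  qed simp
  finally show "l2_inner unit_cube (\<lambda>x::real^'d. \<Prod>l\<in>UNIV. F (\<kappa> l) (x $ l)) (\<lambda>x. \<Prod>l\<in>UNIV. F (\<kappa>' l) (x $ l))
    = (if \<kappa> = \<kappa>' then 1 else 0)" .
qed

text \<open>A product of finite linear combinations, one per coordinate, multiplies out to a finite combination of tensors.\<close>

lemma l2_span_tensor:
  fixes u :: "'d::finite \<Rightarrow> real \<Rightarrow> real" and F :: "'i \<Rightarrow> real \<Rightarrow> real"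
  assumes F: "\<And>i. i \<in> I \<Longrightarrow> F i \<in> l2_set unit_interval"
    and u: "\<And>l. u l \<in> l2_span unit_interval (F ` I)"
  shows "(\<lambda>x. \<Prod>l\<in>UNIV. u l (x $ l)) \<in>
    l2_span unit_cube ((\<lambda>\<kappa> x. \<Prod>l\<in>UNIV. F (\<kappa> l) (x $ l)) ` {\<kappa>. \<forall>l. \<kappa> l \<in> I})"
    (is "_ \<in> l2_span _ ?T")
proof -
  have "\<forall>l. \<exists>Gc. finite (fst Gc) \<and> fst Gc \<subseteq> F ` I \<and>
      (AE y in unit_interval. u l y = (\<Sum>b\<in>fst Gc. snd Gc b * b y))"
  proof
    fix l
    obtain G c where "finite G" "G \<subseteq> F ` I" "AE y in unit_interval. u l y = (\<Sum>b\<in>G. c b * b y)"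
      using u[of l] by (auto simp: l2_span_def)
    then show "\<exists>Gc. finite (fst Gc) \<and> fst Gc \<subseteq> F ` I \<and>
      (AE y in unit_interval. u l y = (\<Sum>b\<in>fst Gc. snd Gc b * b y))"
      by (intro exI[of _ "(G, c)"]) simp
  qed
  from choice[OF this] obtain Gc where Gc: "\<forall>l. finite (fst (Gc l)) \<and> fst (Gc l) \<subseteq> F ` I \<and>
      (AE y in unit_interval. u l y = (\<Sum>b\<in>fst (Gc l). snd (Gc l) b * b y))" ..
  define G c where "G l = fst (Gc l)" and "c l = snd (Gc l)" for l
  have G: "\<And>l. finite (G l)" "\<And>l. G l \<subseteq> F ` I"
    "\<And>l. AE y in unit_interval. u l y = (\<Sum>b\<in>G l. c l b * b y)"
    using Gc unfolding G_def c_def by simp_all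
  have "AE x in (unit_cube :: (real^'d) measure). \<forall>l\<in>UNIV. u l (x $ l) = (\<Sum>b\<in>G l. c l b * b (x $ l))"
    by (rule AE_finite_allI[OF finite AE_unit_cube_component[OF G(3)]])
  then have AE: "AE x in (unit_cube :: (real^'d) measure). (\<Prod>l\<in>UNIV. u l (x $ l))
     = (\<Sum>g\<in>Pi\<^sub>E UNIV G. (\<Prod>l\<in>UNIV. c l (g l)) * (\<Prod>l\<in>UNIV. g l (x $ l)))"
  proof eventually_elim
    fix x :: "real^'d" assume "\<forall>l\<in>UNIV. u l (x $ l) = (\<Sum>b\<in>G l. c l b * b (x $ l))"
    then have "(\<Prod>l\<in>UNIV. u l (x $ l)) = (\<Prod>l\<in>UNIV. \<Sum>b\<in>G l. c l b * b (x $ l))" by simp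
    also have "\<dots> = (\<Sum>g\<in>Pi\<^sub>E UNIV G. \<Prod>l\<in>UNIV. c l (g l) * g l (x $ l))"
      by (intro prod_sum_PiE G(1) finite)
    finally show "(\<Prod>l\<in>UNIV. u l (x $ l))
     = (\<Sum>g\<in>Pi\<^sub>E UNIV G. (\<Prod>l\<in>UNIV. c l (g l)) * (\<Prod>l\<in>UNIV. g l (x $ l)))"
      by (simp only: prod.distrib)
  qed
  have "(\<lambda>x::real^'d. \<Sum>g\<in>Pi\<^sub>E UNIV G. (\<Prod>l\<in>UNIV. c l (g l)) * (\<Prod>l\<in>UNIV. g l (x $ l))) \<in> l2_span unit_cube ?T"
  proof (rule l2_span_lincomb, rule l2_span_base)
    fix g assume g: "g \<in> Pi\<^sub>E UNIV G"
    then have "g l \<in> F ` I" for l using G(2)[of l] by (auto simp: PiE_iff)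
    then have gI: "\<forall>l. \<exists>i. i \<in> I \<and> g l = F i" by blast
    from choice[OF gI] obtain \<kappa> where "\<forall>l. \<kappa> l \<in> I \<and> g l = F (\<kappa> l)" ..
    then have k: "\<And>l. \<kappa> l \<in> I" "\<And>l. g l = F (\<kappa> l)" by simp_all
    from k show "(\<lambda>x. \<Prod>l\<in>UNIV. g l (x $ l)) \<in> ?T" by (intro image_eqI[of _ _ \<kappa>]) auto
    show "(\<lambda>x. \<Prod>l\<in>UNIV. g l (x $ l)) \<in> l2_set unit_cube"
      by (rule l2_set_tensor) (simp add: k F)
  qed
  moreover have "(\<lambda>x::real^'d. \<Prod>l\<in>UNIV. u l (x $ l)) \<in> l2_set unit_cube"
    using u by (intro l2_set_tensor) (auto simp: l2_span_def)
  ultimately show ?thesis using l2_span_cong_AE AE by blast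
qed

section \<open>The lower bound for random sign alternatives\<close>

lemma pair_law_kernel:
  fixes f :: "real ^ 'd \<Rightarrow> real"
  assumes [measurable]: "f \<in> borel_measurable unit_cube"
  shows "(\<lambda>x. distr (measure_pmf (bernoulli_pmf (f x))) obs_space (\<lambda>y. (x, y)))
    \<in> unit_cube \<rightarrow>\<^sub>M subprob_algebra obs_space"
proof (rule measurable_distr2)
  show "(\<lambda>(x, y). (x, y)) \<in> (unit_cube :: (real^'d) measure) \<Otimes>\<^sub>M count_space UNIV \<rightarrow>\<^sub>M obs_space"
    unfolding case_prod_Pair_iden
    by (intro measurable_ident_sets sets_pair_measure_cong sets_restrict_space_cong) auto
  show "(\<lambda>x. measure_pmf (bernoulli_pmf (f x))) \<in> unit_cube \<rightarrow>\<^sub>M subprob_algebra (count_space UNIV)"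
  proof (rule measurable_subprob_algebra)
    fix A :: "bool set"
    have "emeasure (measure_pmf (bernoulli_pmf (f a))) A
       = (\<Sum>b\<in>A. ennreal (if b then min 1 (max 0 (f a)) else 1 - min 1 (max 0 (f a))))" for a
      by (subst emeasure_measure_pmf_finite)
        (auto simp: bernoulli_pmf.rep_eq intro!: sum.cong)
    then show "(\<lambda>a. emeasure (measure_pmf (bernoulli_pmf (f a))) A) \<in> borel_measurable unit_cube"
      by simp
  qed (auto simp: prob_space_imp_subprob_space measure_pmf.prob_space_axioms)
qed

lemma sets_pair_law:
  fixes f :: "real ^ 'd \<Rightarrow> real"
  shows "sets (pair_law f (\<lambda>_. 1)) = sets obs_space"
proof -
  have "(0::real^'d) \<in> cbox 0 1" by (simp add: mem_box Basis_vec_def inner_axis)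
  then have "space (density unit_cube (\<lambda>x::real^'d. ennreal 1)) \<noteq> {}"
    by (auto simp: space_restrict_space)
  then show ?thesis
    unfolding pair_law_def by (subst sets_bind[where N="obs_space"]) auto
qed

text \<open>All later computations with the law of one observation go through this formula, which replaces the monadic
definition by an integral over the design.\<close>

lemma nn_integral_pair_law:
  fixes f :: "real ^ 'd \<Rightarrow> real"
  assumes f[measurable]: "f \<in> borel_measurable unit_cube"
    and f01: "\<And>x. x \<in> cbox 0 1 \<Longrightarrow> 0 \<le> f x \<and> f x \<le> 1"
    and F: "F \<in> borel_measurable obs_space"
  shows "(\<integral>\<^sup>+z. F z \<partial>pair_law f (\<lambda>_. 1)) =
    (\<integral>\<^sup>+x. F (x, True) * ennreal (f x) + F (x, False) * ennreal (1 - f x) \<partial>unit_cube)"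
proof -
  have "density (unit_cube :: (real^'d) measure) (\<lambda>x. ennreal 1) = unit_cube"
    by (simp add: density_1)
  then have "(\<integral>\<^sup>+z. F z \<partial>pair_law f (\<lambda>_. 1)) = (\<integral>\<^sup>+x. \<integral>\<^sup>+z. F z
      \<partial>distr (measure_pmf (bernoulli_pmf (f x))) obs_space (\<lambda>y. (x, y)) \<partial>unit_cube)"
    unfolding pair_law_def
    using nn_integral_bind[OF F pair_law_kernel[OF f]] by simp
  also have "\<dots> = (\<integral>\<^sup>+x. F (x, True) * ennreal (f x) + F (x, False) * ennreal (1 - f x) \<partial>unit_cube)"
  proof (intro nn_integral_cong)
    fix x :: "real^'d" assume "x \<in> space unit_cube"
    then have x: "x \<in> cbox 0 1" by (simp add: space_restrict_space)
    have "(\<lambda>y. (x, y)) \<in> measure_pmf (bernoulli_pmf (f x)) \<rightarrow>\<^sub>M obs_space"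
      using x by (auto simp: space_pair_measure space_restrict_space)
    then show "(\<integral>\<^sup>+z. F z \<partial>distr (measure_pmf (bernoulli_pmf (f x))) obs_space (\<lambda>y. (x, y)))
       = F (x, True) * ennreal (f x) + F (x, False) * ennreal (1 - f x)"
      using f01[OF x] F by (subst nn_integral_distr) auto
  qed
  finally show ?thesis .
qed

lemma prob_space_pair_law:
  fixes f :: "real ^ 'd \<Rightarrow> real"
  assumes "f \<in> borel_measurable unit_cube" "\<And>x. x \<in> cbox 0 1 \<Longrightarrow> 0 \<le> f x \<and> f x \<le> 1"
  shows "prob_space (pair_law f (\<lambda>_. 1))"
proof
  interpret U: prob_space "unit_cube :: (real^'d) measure" by (rule prob_space_unit_cube)
  have "emeasure (pair_law f (\<lambda>_. 1)) (space (pair_law f (\<lambda>_. 1))) = (\<integral>\<^sup>+z. 1 \<partial>pair_law f (\<lambda>_. 1))"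
    by simp
  also have "\<dots> = (\<integral>\<^sup>+x. 1 * ennreal (f x) + 1 * ennreal (1 - f x) \<partial>unit_cube)"
    by (rule nn_integral_pair_law) (use assms in auto)
  also have "\<dots> = (\<integral>\<^sup>+x. 1 \<partial>(unit_cube :: (real^'d) measure))"
    using assms(2) by (intro nn_integral_cong) (auto simp: space_restrict_space simp flip: ennreal_plus)
  also have "\<dots> = 1" using U.emeasure_space_1 by simp
  finally show "emeasure (pair_law f (\<lambda>_. 1)) (space (pair_law f (\<lambda>_. 1))) = 1" .
qed

text \<open>The likelihood ratio of one observation under the regression function \<open>c + h\<close> against the constant \<open>c\<close>.\<close>

definition bernoulli_lr :: "real \<Rightarrow> (real ^ 'd \<Rightarrow> real) \<Rightarrow> (real ^ 'd) \<times> bool \<Rightarrow> real" where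
  "bernoulli_lr c h z = (if snd z then 1 + h (fst z) / c else 1 - h (fst z) / (1 - c))"

lemma measurable_bernoulli_lr [measurable]:
  fixes h :: "real ^ 'd \<Rightarrow> real"
  assumes "h \<in> borel_measurable unit_cube"
  shows "bernoulli_lr c h \<in> borel_measurable obs_space"
proof -
  have [measurable]: "h \<in> borel_measurable (restrict_space borel (cbox 0 1))"
    using assms by (subst measurable_cong_sets[where M'=unit_cube and N'=borel])
      (auto simp: sets_restrict_space)
  show ?thesis unfolding bernoulli_lr_def by measurable
qed

lemma pair_law_eq_density:
  fixes h :: "real ^ 'd \<Rightarrow> real"
  assumes c: "0 < c" "c \<le> 1/2" and h[measurable]: "h \<in> borel_measurable unit_cube"
    and hc: "\<And>x. x \<in> cbox 0 1 \<Longrightarrow> \<bar>h x\<bar> \<le> c"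
  shows "pair_law (\<lambda>x. c + h x) (\<lambda>_. 1) = density (pair_law (\<lambda>_. c) (\<lambda>_. 1)) (bernoulli_lr c h)"
proof (rule measure_eqI)
  show "sets (pair_law (\<lambda>x. c + h x) (\<lambda>_. 1)) = sets (density (pair_law (\<lambda>_. c) (\<lambda>_. 1)) (bernoulli_lr c h))"
    by (simp add: sets_pair_law)
  fix A assume "A \<in> sets (pair_law (\<lambda>x. c + h x) (\<lambda>_. 1))"
  then have A[measurable]: "A \<in> sets obs_space" by (simp add: sets_pair_law)
  note m = measurable_bernoulli_lr[OF h, of c]
  have bd: "0 \<le> c + h x \<and> c + h x \<le> 1" if "x \<in> cbox 0 1" for x
    using hc[OF that] c by linarith
  have "emeasure (pair_law (\<lambda>x. c + h x) (\<lambda>_. 1)) A = (\<integral>\<^sup>+z. indicator A z \<partial>pair_law (\<lambda>x. c + h x) (\<lambda>_. 1))"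
    using A by (simp add: sets_pair_law)
  also have "\<dots> = (\<integral>\<^sup>+x. indicator A (x, True) * ennreal (c + h x)
      + indicator A (x, False) * ennreal (1 - (c + h x)) \<partial>unit_cube)"
    by (rule nn_integral_pair_law) (use bd in auto)
  also have "\<dots> = (\<integral>\<^sup>+x. (ennreal (bernoulli_lr c h (x, True)) * indicator A (x, True)) * ennreal c
      + (ennreal (bernoulli_lr c h (x, False)) * indicator A (x, False)) * ennreal (1 - c) \<partial>unit_cube)"
  proof (intro nn_integral_cong)
    fix x :: "real^'d" assume "x \<in> space unit_cube"
    then have x: "\<bar>h x\<bar> \<le> c" using hc by (simp add: space_restrict_space)
    have 1: "ennreal (1 + h x / c) * ennreal c = ennreal (c + h x)"
      using c x by (subst ennreal_mult''[symmetric]) (auto simp: distrib_right)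
    have "(1 - h x / (1 - c)) * (1 - c) = 1 - (c + h x)"
      using c by (simp add: left_diff_distrib)
    then have 2: "ennreal (1 - h x / (1 - c)) * ennreal (1 - c) = ennreal (1 - (c + h x))"
      using c by (subst ennreal_mult''[symmetric]) auto
    show "indicator A (x, True) * ennreal (c + h x) + indicator A (x, False) * ennreal (1 - (c + h x)) =
      (ennreal (bernoulli_lr c h (x, True)) * indicator A (x, True)) * ennreal c
      + (ennreal (bernoulli_lr c h (x, False)) * indicator A (x, False)) * ennreal (1 - c)"
      unfolding bernoulli_lr_def using 1 2 by (auto split: split_indicator)
  qed
  also have "\<dots> = (\<integral>\<^sup>+z. ennreal (bernoulli_lr c h z) * indicator A z \<partial>pair_law (\<lambda>_. c) (\<lambda>_. 1))"
    by (rule nn_integral_pair_law[symmetric]) (use c m in auto)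
  also have "\<dots> = emeasure (density (pair_law (\<lambda>_. c) (\<lambda>_. 1)) (bernoulli_lr c h)) A"
    using m A by (subst emeasure_density) (simp_all add: measurable_cong_sets[OF sets_pair_law refl] sets_pair_law)
  finally show "emeasure (pair_law (\<lambda>x. c + h x) (\<lambda>_. 1)) A
    = emeasure (density (pair_law (\<lambda>_. c) (\<lambda>_. 1)) (bernoulli_lr c h)) A" .
qed

lemma bernoulli_lr_bounds:
  assumes c: "0 < c" "c \<le> 1/2" and "\<bar>h x\<bar> \<le> c"
  shows "0 \<le> bernoulli_lr c h (x, y)" "bernoulli_lr c h (x, y) \<le> 2"
proof -
  have "-1 \<le> h x / c" "h x / c \<le> 1" "-1 \<le> h x / (1 - c)" "h x / (1 - c) \<le> 1"
    using assms by (auto simp: field_simps)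
  then show "0 \<le> bernoulli_lr c h (x, y)" "bernoulli_lr c h (x, y) \<le> 2"
    unfolding bernoulli_lr_def by auto
qed

text \<open>Given the design point, the response averages the linear terms \<open>h x\<close> and \<open>h' x\<close> out: they enter with weight
\<open>c \<cdot> 1 / c\<close> for a success and \<open>- (1 - c) \<cdot> 1 / (1 - c)\<close> for a failure.  Only the product survives, with
factor \<open>1 / c + 1 / (1 - c) = 1 / (c (1 - c))\<close>.\<close>

lemma bernoulli_lr_inner:
  fixes h h' :: "real ^ 'd \<Rightarrow> real"
  assumes c: "0 < c" "c \<le> 1/2"
    and h[measurable]: "h \<in> borel_measurable unit_cube" "h' \<in> borel_measurable unit_cube"
    and hc: "\<And>x. x \<in> cbox 0 1 \<Longrightarrow> \<bar>h x\<bar> \<le> c" "\<And>x. x \<in> cbox 0 1 \<Longrightarrow> \<bar>h' x\<bar> \<le> c"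
  shows "(\<integral>z. bernoulli_lr c h z * bernoulli_lr c h' z \<partial>pair_law (\<lambda>_. c) (\<lambda>_. 1))
    = 1 + l2_inner unit_cube h h' / (c * (1 - c))"
proof -
  interpret U: prob_space "unit_cube :: (real^'d) measure" by (rule prob_space_unit_cube)
  note m = measurable_bernoulli_lr[OF h(1), of c] measurable_bernoulli_lr[OF h(2), of c]
  have pos: "0 \<le> bernoulli_lr c h z * bernoulli_lr c h' z" if "z \<in> space obs_space" for z
    using that bernoulli_lr_bounds(1)[OF c, of h "fst z" "snd z"] hc[of "fst z"]
      bernoulli_lr_bounds(1)[OF c, of h' "fst z" "snd z"]
    by (auto simp: space_pair_measure space_restrict_space)
  have sp: "space (pair_law (\<lambda>_. c) (\<lambda>_. 1) :: ((real^'d) \<times> bool) measure) = space obs_space"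
    by (rule sets_eq_imp_space_eq[OF sets_pair_law])
  have alg: "(1 + a / c) * (1 + b / c) * c + (1 - a / (1 - c)) * (1 - b / (1 - c)) * (1 - c)
      = 1 + a * b / (c * (1 - c))" for a b
  proof -
    define u v where "u = 1 / c" and "v = 1 / (1 - c)"
    have uv: "c * u = 1" "(1 - c) * v = 1" using c by (auto simp: u_def v_def)
    then have "(1 + a * u) * (1 + b * u) * c + (1 - a * v) * (1 - b * v) * (1 - c) = 1 + a * b * (u * v)"
      by algebra
    then show ?thesis by (simp add: u_def v_def)
  qed
  have int: "integrable (unit_cube :: (real^'d) measure) (\<lambda>x. h x * h' x)"
  proof (rule U.integrable_const_bound)
    show "AE x in unit_cube. norm (h x * h' x) \<le> c * c"
      using hc by (intro AE_I2) (use c in \<open>auto simp: space_restrict_space abs_mult intro!: mult_mono\<close>)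
  qed measurable
  have "(\<integral>\<^sup>+z. ennreal (bernoulli_lr c h z * bernoulli_lr c h' z) \<partial>pair_law (\<lambda>_. c) (\<lambda>_. 1))
    = (\<integral>\<^sup>+x. ennreal (bernoulli_lr c h (x, True) * bernoulli_lr c h' (x, True)) * ennreal c +
         ennreal (bernoulli_lr c h (x, False) * bernoulli_lr c h' (x, False)) * ennreal (1 - c) \<partial>unit_cube)"
    by (rule nn_integral_pair_law) (use c m in auto)
  also have "\<dots> = (\<integral>\<^sup>+x. ennreal (1 + h x * h' x / (c * (1 - c))) \<partial>unit_cube)"
  proof (intro nn_integral_cong)
    fix x :: "real^'d" assume "x \<in> space unit_cube"
    then have x: "x \<in> cbox 0 1" by (simp add: space_restrict_space)
    have "0 \<le> bernoulli_lr c h (x, y) * bernoulli_lr c h' (x, y)" for y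
      using bernoulli_lr_bounds(1)[OF c, of h x y] bernoulli_lr_bounds(1)[OF c, of h' x y] hc[OF x] by auto
    then show "ennreal (bernoulli_lr c h (x, True) * bernoulli_lr c h' (x, True)) * ennreal c +
         ennreal (bernoulli_lr c h (x, False) * bernoulli_lr c h' (x, False)) * ennreal (1 - c)
       = ennreal (1 + h x * h' x / (c * (1 - c)))"
      using c alg[of "h x" "h' x"]
      by (simp add: ennreal_plus[symmetric] ennreal_mult''[symmetric] del: ennreal_plus)
        (simp add: bernoulli_lr_def)
  qed
  finally have "(\<integral>z. bernoulli_lr c h z * bernoulli_lr c h' z \<partial>pair_law (\<lambda>_. c) (\<lambda>_. 1))
     = enn2real (\<integral>\<^sup>+x. ennreal (1 + h x * h' x / (c * (1 - c))) \<partial>unit_cube)"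
    using m pos by (subst integral_eq_nn_integral)
      (auto simp: measurable_cong_sets[OF sets_pair_law refl] sp intro!: AE_I2)
  also have "\<dots> = (\<integral>x. 1 + h x * h' x / (c * (1 - c)) \<partial>unit_cube)"
  proof (subst integral_eq_nn_integral)
    have "0 \<le> 1 + h x * h' x / (c * (1 - c))" if "x \<in> cbox 0 1" for x
    proof -
      have "\<bar>h x * h' x\<bar> \<le> c * c" using hc[OF that] c by (auto simp: abs_mult intro!: mult_mono)
      also have "\<dots> \<le> c * (1 - c)" using c by (intro mult_left_mono) auto
      finally have "- (c * (1 - c)) \<le> h x * h' x" by linarith
      moreover have "0 < c * (1 - c)" using c by simp
      ultimately have "-1 \<le> h x * h' x / (c * (1 - c))" by (simp only: pos_le_divide_eq)
      then show ?thesis by linarith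
    qed
    then show "AE x in unit_cube. 0 \<le> 1 + h x * h' x / (c * (1 - c))"
      by (intro AE_I2) (simp add: space_restrict_space)
  qed auto
  also have "\<dots> = 1 + l2_inner unit_cube h h' / (c * (1 - c))"
    using int U.prob_space unfolding l2_inner_def by (subst Bochner_Integration.integral_add) auto
  finally show ?thesis .
qed

lemma density_PiM:
  assumes I: "finite I" and P: "prob_space P" "prob_space (density P L)" and L[measurable]: "L \<in> borel_measurable P"
  shows "(\<Pi>\<^sub>M i\<in>I. density P L) = density (\<Pi>\<^sub>M i\<in>I. P) (\<lambda>\<omega>. \<Prod>i\<in>I. L (\<omega> i))"
proof -
  interpret P: product_prob_space "\<lambda>_. P" I
    using P by (simp add: product_prob_space_def product_prob_space_axioms_def product_sigma_finite_def prob_space_imp_sigma_finite)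
  interpret D: product_prob_space "\<lambda>_. density P L" I
    using P by (simp add: product_prob_space_def product_prob_space_axioms_def product_sigma_finite_def prob_space_imp_sigma_finite)
  show ?thesis
  proof (rule D.PiM_eqI[symmetric])
    show "sets (density (\<Pi>\<^sub>M i\<in>I. P) (\<lambda>\<omega>. \<Prod>i\<in>I. L (\<omega> i))) = sets (\<Pi>\<^sub>M i\<in>I. density P L)"
      by (simp, intro sets_PiM_cong) auto
    fix A assume "\<And>i. i \<in> I \<Longrightarrow> A i \<in> sets (density P L)"
    then have A[measurable]: "\<And>i. i \<in> I \<Longrightarrow> A i \<in> sets P" by simp
    have "emeasure (density (\<Pi>\<^sub>M i\<in>I. P) (\<lambda>\<omega>. \<Prod>i\<in>I. L (\<omega> i))) (Pi\<^sub>E I A)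
       = (\<integral>\<^sup>+\<omega>. (\<Prod>i\<in>I. L (\<omega> i)) * indicator (Pi\<^sub>E I A) \<omega> \<partial>(\<Pi>\<^sub>M i\<in>I. P))"
      using I A by (intro emeasure_density sets_PiM_I_finite) auto
    also have "\<dots> = (\<integral>\<^sup>+\<omega>. (\<Prod>i\<in>I. L (\<omega> i) * indicator (A i) (\<omega> i)) \<partial>(\<Pi>\<^sub>M i\<in>I. P))"
    proof (intro nn_integral_cong)
      fix \<omega> assume "\<omega> \<in> space (\<Pi>\<^sub>M i\<in>I. P)"
      then have "indicator (Pi\<^sub>E I A) \<omega> = (\<Prod>i\<in>I. indicator (A i) (\<omega> i) :: ennreal)"
        using I by (auto simp: space_PiM PiE_iff indicator_def prod_zero_iff)
      then show "(\<Prod>i\<in>I. L (\<omega> i)) * indicator (Pi\<^sub>E I A) \<omega> = (\<Prod>i\<in>I. L (\<omega> i) * indicator (A i) (\<omega> i))"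
        by (simp add: prod.distrib)
    qed
    also have "\<dots> = (\<Prod>i\<in>I. \<integral>\<^sup>+x. L x * indicator (A i) x \<partial>P)"
      using I by (intro P.product_nn_integral_prod) auto
    also have "\<dots> = (\<Prod>i\<in>I. emeasure (density P L) (A i))"
      by (intro prod.cong refl emeasure_density[symmetric]) auto
    finally show "emeasure (density (\<Pi>\<^sub>M i\<in>I. P) (\<lambda>\<omega>. \<Prod>i\<in>I. L (\<omega> i))) (Pi\<^sub>E I A)
      = (\<Prod>i\<in>I. emeasure (density P L) (A i))" .
  qed fact
qed

text \<open>Le Cam's argument: \<open>D\<close> is the density of the mixture of alternatives and \<open>A\<close> the rejection region.
Pointwise the integrand of the error sum is at least \<open>1 - \<bar>D - 1\<bar>\<close>, and the \<open>L\<^sup>1\<close> norm of \<open>D - 1\<close> is at most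
its \<open>L\<^sup>2\<close> norm.\<close>

lemma (in prob_space) chi_square_testing_bound:
  assumes D: "integrable M D" "integrable M (\<lambda>x. (D x)\<^sup>2)" "expectation D = 1" and A: "A \<in> events"
  shows "1 - sqrt (expectation (\<lambda>x. (D x)\<^sup>2) - 1) \<le> prob A + expectation (\<lambda>x. D x * indicator (space M - A) x)"
proof -
  have i2: "integrable M (\<lambda>x. (D x - 1)\<^sup>2)"
    using D by (simp add: power2_diff)
  have i1: "integrable M (\<lambda>x. \<bar>D x - 1\<bar>)" using D by auto
  have iA: "integrable M (indicator A :: _ \<Rightarrow> real)" "integrable M (\<lambda>x. D x * indicator (space M - A) x)"
    using D A by (auto intro!: integrable_real_mult_indicator simp: integrable_indicator_iff less_top[symmetric])
  have "(expectation (\<lambda>x. \<bar>D x - 1\<bar>))\<^sup>2 \<le> expectation (\<lambda>x. \<bar>D x - 1\<bar>\<^sup>2)"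
    using variance_positive[of "\<lambda>x. \<bar>D x - 1\<bar>"] variance_eq[OF i1] i2 by simp
  also have "\<dots> = expectation (\<lambda>x. (D x)\<^sup>2) - 1"
    using D by (simp add: power2_diff prob_space)
  finally have 1: "expectation (\<lambda>x. \<bar>D x - 1\<bar>) \<le> sqrt (expectation (\<lambda>x. (D x)\<^sup>2) - 1)"
    by (rule real_le_rsqrt)
  have "1 - expectation (\<lambda>x. \<bar>D x - 1\<bar>) = expectation (\<lambda>x. 1 - \<bar>D x - 1\<bar>)"
    using i1 by (simp add: prob_space)
  also have "\<dots> \<le> expectation (\<lambda>x. indicator A x + D x * indicator (space M - A) x)"
    using i1 iA D A by (intro integral_mono) (auto split: split_indicator)
  also have "\<dots> = prob A + expectation (\<lambda>x. D x * indicator (space M - A) x)"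
    using iA A by (subst Bochner_Integration.integral_add) auto
  finally show ?thesis using 1 by simp
qed

text \<open>This is Hoeffding's lemma for a fair sign, in its logarithmic form with interval length \<open>2\<close>.\<close>

lemma cosh_le_exp_half_square: "cosh (t::real) \<le> exp (t\<^sup>2 / 2)"
proof -
  have "cosh u \<le> exp (u\<^sup>2 / 2)" if "u \<ge> 0" for u :: real
  proof -
    have "exp (- u) * (1 + 1 / 2 * (exp (2 * u) - 1)) = cosh u"
      by (simp add: cosh_field_def algebra_simps flip: exp_add)
    then have "ln (cosh u) = ln (exp (- u) * (1 + 1 / 2 * (exp (2 * u) - 1)))" by simp
    also have "\<dots> = - u + ln (1 + 1 / 2 * (exp (2 * u) - 1))"
    proof -
      have "0 < exp (2 * u)" by (rule exp_gt_zero)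
      then have "0 < 1 + 1 / 2 * (exp (2 * u) - 1)" by argo
      then show ?thesis by (subst ln_mult) auto
    qed
    also have "\<dots> \<le> u\<^sup>2 / 2"
      using Hoeffdings_lemma_aux[of "2 * u" "1/2"] that by (simp add: power_mult_distrib)
    finally have "ln (cosh u) \<le> ln (exp (u\<^sup>2 / 2))" by simp
    then show ?thesis using cosh_real_pos[of u] by (subst (asm) ln_le_cancel_iff) auto
  qed
  from this[of "\<bar>t\<bar>"] show ?thesis by (cases "t \<ge> 0") auto
qed

text \<open>For fixed \<open>\<beta>\<close> the products \<open>\<beta> k * \<beta>' k\<close> are again independent fair signs, so the sum over \<open>\<beta>'\<close> factorizes
into equal factors \<open>2 cosh s\<close>.\<close>

lemma rademacher_exponential_moment:
  fixes s :: real
  assumes L: "finite \<Lambda>"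
  defines "B \<equiv> PiE \<Lambda> (\<lambda>_. {-1, 1::real})"
  shows "(\<Sum>\<beta>\<in>B. \<Sum>\<beta>'\<in>B. exp (s * (\<Sum>k\<in>\<Lambda>. \<beta> k * \<beta>' k))) \<le> (real (card B))\<^sup>2 * exp (card \<Lambda> * s\<^sup>2 / 2)"
proof -
  have card: "card B = 2 ^ card \<Lambda>" unfolding B_def using L by (simp add: card_PiE numeral_2_eq_2)
  have "(\<Sum>\<beta>'\<in>B. exp (s * (\<Sum>k\<in>\<Lambda>. \<beta> k * \<beta>' k))) = (2 * cosh s) ^ card \<Lambda>" if \<beta>: "\<beta> \<in> B" for \<beta>
  proof -
    have "(\<Sum>\<beta>'\<in>B. exp (s * (\<Sum>k\<in>\<Lambda>. \<beta> k * \<beta>' k))) = (\<Sum>\<beta>'\<in>B. \<Prod>k\<in>\<Lambda>. exp (s * (\<beta> k * \<beta>' k)))"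
      using L by (simp add: sum_distrib_left exp_sum)
    also have "\<dots> = (\<Prod>k\<in>\<Lambda>. \<Sum>b\<in>{-1, 1}. exp (s * (\<beta> k * b)))"
      unfolding B_def using L by (subst prod_sum_PiE) auto
    also have "\<dots> = (\<Prod>k\<in>\<Lambda>. 2 * cosh s)"
    proof (intro prod.cong refl)
      fix k assume "k \<in> \<Lambda>"
      then have "\<beta> k = 1 \<or> \<beta> k = - 1" using \<beta> unfolding B_def by (auto simp: PiE_iff)
      then show "(\<Sum>b\<in>{-1, 1}. exp (s * (\<beta> k * b))) = 2 * cosh s"
        by (auto simp: cosh_field_def)
    qed
    finally show ?thesis by simp
  qed
  then have "(\<Sum>\<beta>\<in>B. \<Sum>\<beta>'\<in>B. exp (s * (\<Sum>k\<in>\<Lambda>. \<beta> k * \<beta>' k))) = (real (card B))\<^sup>2 * cosh s ^ card \<Lambda>"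
    by (simp add: card power_mult_distrib power2_eq_square)
  also have "\<dots> \<le> (real (card B))\<^sup>2 * exp (s\<^sup>2 / 2) ^ card \<Lambda>"
    by (intro mult_left_mono power_mono cosh_le_exp_half_square) auto
  finally show ?thesis by (simp add: exp_of_nat_mult[symmetric])
qed

text \<open>The supremum over the alternatives is at least their average, so the error sum is at least that of testing \<open>c\<close>
against the uniform mixture over signs.  Its likelihood ratio \<open>D\<close> has second moment
equal to the average over pairs of \<open>(1 + s \<langle>\<beta>, \<beta>'\<rangle>) ^ n\<close>, and \<open>1 + x \<le> exp x\<close> turns this into a
Rademacher exponential moment.\<close>

lemma ingster_lower_bound:
  fixes e :: "'k \<Rightarrow> real ^ 'd \<Rightarrow> real" and \<gamma> c :: real
  assumes c: "0 < c" "c \<le> 1/2" and \<Lambda>: "finite \<Lambda>" and e: "l2_orthonormal unit_cube \<Lambda> e"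
  defines "B \<equiv> PiE \<Lambda> (\<lambda>_. {-1, 1::real})"
  assumes sup: "\<And>\<beta> x. \<beta> \<in> B \<Longrightarrow> x \<in> cbox 0 1 \<Longrightarrow> \<bar>\<gamma> * (\<Sum>k\<in>\<Lambda>. \<beta> k * e k x)\<bar> \<le> c"
    and \<phi>: "\<phi> \<in> tests n"
  shows "ennreal (1 - sqrt (exp (card \<Lambda> * (n * \<gamma>\<^sup>2 / (c * (1 - c)))\<^sup>2 / 2) - 1)) \<le>
     emeasure (sample_law n (\<lambda>_. c) (\<lambda>_. 1)) {\<omega> \<in> space (sample_law n (\<lambda>_. c) (\<lambda>_. 1)). \<phi> \<omega> = 1} +
     (SUP \<beta>\<in>B. emeasure (sample_law n (\<lambda>x. c + \<gamma> * (\<Sum>k\<in>\<Lambda>. \<beta> k * e k x)) (\<lambda>_. 1))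
        {\<omega> \<in> space (sample_law n (\<lambda>x. c + \<gamma> * (\<Sum>k\<in>\<Lambda>. \<beta> k * e k x)) (\<lambda>_. 1)). \<phi> \<omega> = 0})"
    (is "_ \<le> _ + (SUP \<beta>\<in>B. ?err \<beta>)")
proof -
  define P where "P = pair_law (\<lambda>_::real^'d. c) (\<lambda>_. 1)"
  define Q where "Q = (\<Pi>\<^sub>M i\<in>{..<n}. P)"
  define h where "h \<beta> x = \<gamma> * (\<Sum>k\<in>\<Lambda>. \<beta> k * e k x)" for \<beta> x
  define L where "L \<beta> = bernoulli_lr c (h \<beta>)" for \<beta>
  define G where "G \<beta> \<omega> = (\<Prod>i<n. L \<beta> (\<omega> i))" for \<beta> \<omega>
  define s where "s = \<gamma>\<^sup>2 / (c * (1 - c))"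
  define N where "N = real (card B)"
  define D where "D \<omega> = (\<Sum>\<beta>\<in>B. G \<beta> \<omega>) / N" for \<omega>
  define A where "A = {\<omega> \<in> space Q. \<phi> \<omega> = 1}"
  have B: "finite B" "B \<noteq> {}" unfolding B_def using \<Lambda> by (auto simp: PiE_eq_empty_iff finite_PiE)
  then have N: "N > 0" unfolding N_def by (simp add: card_gt_0_iff)
  interpret U: prob_space "unit_cube :: (real^'d) measure" by (rule prob_space_unit_cube)
  interpret P: prob_space P unfolding P_def using c by (intro prob_space_pair_law) auto
  interpret PP: product_prob_space "\<lambda>_. P" "{..<n}"
    using P.prob_space_axioms
    by (simp add: product_prob_space_def product_prob_space_axioms_def product_sigma_finite_def prob_space_imp_sigma_finite)
  interpret Q: prob_space Q unfolding Q_def by (intro prob_space_PiM P.prob_space_axioms)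
  have sP: "sets P = sets obs_space" unfolding P_def by (rule sets_pair_law)
  have spP: "space P = space obs_space" by (rule sets_eq_imp_space_eq[OF sP])
  have mh: "h \<beta> \<in> borel_measurable unit_cube" for \<beta>
  proof -
    have "\<And>k. k \<in> \<Lambda> \<Longrightarrow> e k \<in> borel_measurable unit_cube"
      using e by (auto simp: l2_orthonormal_def l2_set_def)
    then show ?thesis unfolding h_def by simp
  qed
  have hc: "\<bar>h \<beta> x\<bar> \<le> c" if "\<beta> \<in> B" "x \<in> cbox 0 1" for \<beta> x
    unfolding h_def using sup[OF that] .
  have L_meas[measurable]: "L \<beta> \<in> borel_measurable P" for \<beta>
    unfolding L_def measurable_cong_sets[OF sP refl] by (rule measurable_bernoulli_lr[OF mh])
  have L_bd: "0 \<le> L \<beta> z" "L \<beta> z \<le> 2" if "\<beta> \<in> B" "z \<in> space P" for \<beta> z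
    using bernoulli_lr_bounds[OF c, of "h \<beta>" "fst z" "snd z"] hc[OF that(1), of "fst z"] that(2)
    unfolding L_def spP by (auto simp: space_pair_measure space_restrict_space)
  have int_P: "integrable P f" if "f \<in> borel_measurable P" "\<And>z. z \<in> space P \<Longrightarrow> \<bar>f z\<bar> \<le> b" for f and b :: real
    using that by (intro P.integrable_const_bound[of _ b] AE_I2) auto
  have int_L: "integrable P (L \<beta>)" if "\<beta> \<in> B" for \<beta>
    using L_bd[OF that] by (intro int_P[of _ 2]) auto
  have int_LL: "integrable P (\<lambda>z. L \<beta> z * L \<beta>' z)" if "\<beta> \<in> B" "\<beta>' \<in> B" for \<beta> \<beta>'
  proof (intro int_P[of _ "2 * 2"])
    show "\<bar>L \<beta> z * L \<beta>' z\<bar> \<le> 2 * 2" if "z \<in> space P" for z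
      using L_bd[OF \<open>\<beta> \<in> B\<close> that] L_bd[OF \<open>\<beta>' \<in> B\<close> that] unfolding abs_mult by (intro mult_mono) auto
  qed simp
  have inner_h: "l2_inner unit_cube (h \<beta>) (h \<beta>') = \<gamma>\<^sup>2 * (\<Sum>k\<in>\<Lambda>. \<beta> k * \<beta>' k)" for \<beta> \<beta>'
  proof -
    have "l2_inner unit_cube (h \<beta>) (h \<beta>') = l2_inner unit_cube
       (\<lambda>x. \<Sum>k\<in>\<Lambda>. (\<gamma> * \<beta> k) * e k x) (\<lambda>x. \<Sum>k\<in>\<Lambda>. (\<gamma> * \<beta>' k) * e k x)"
      unfolding h_def by (simp add: sum_distrib_left mult.assoc)
    also have "\<dots> = (\<Sum>k\<in>\<Lambda>. (\<gamma> * \<beta> k) * (\<gamma> * \<beta>' k))"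
      by (rule l2_inner_orthonormal_sums[OF e \<Lambda>])
    finally show ?thesis by (simp add: sum_distrib_left power2_eq_square algebra_simps)
  qed
  have LL: "(\<integral>z. L \<beta> z * L \<beta>' z \<partial>P) = 1 + s * (\<Sum>k\<in>\<Lambda>. \<beta> k * \<beta>' k)" if "\<beta> \<in> B" "\<beta>' \<in> B" for \<beta> \<beta>'
    using bernoulli_lr_inner[OF c mh mh hc[OF that(1)] hc[OF that(2)]]
    unfolding L_def P_def inner_h s_def by simp
  have one: "bernoulli_lr c (\<lambda>_. 0) z = 1" for z :: "(real^'d) \<times> bool"
    by (simp add: bernoulli_lr_def)
  \<comment> \<open>the likelihood ratio against itself is \<open>1\<close>, so the total mass is an inner product\<close>
  have L1: "(\<integral>z. L \<beta> z \<partial>P) = 1" if "\<beta> \<in> B" for \<beta>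
    using bernoulli_lr_inner[OF c mh, of "\<lambda>_. 0" \<beta>] hc[OF that] c
    unfolding L_def P_def by (simp add: one l2_inner_def)
  have int_G: "integrable Q (G \<beta>)" if "\<beta> \<in> B" for \<beta>
    unfolding G_def Q_def using int_L[OF that] by (intro PP.product_integrable_prod) auto
  have G1: "(\<integral>\<omega>. G \<beta> \<omega> \<partial>Q) = 1" if "\<beta> \<in> B" for \<beta>
    unfolding G_def Q_def using int_L[OF that] L1[OF that] by (subst PP.product_integral_prod) auto
  have GG: "G \<beta> \<omega> * G \<beta>' \<omega> = (\<Prod>i<n. L \<beta> (\<omega> i) * L \<beta>' (\<omega> i))" for \<beta> \<beta>' \<omega>
    unfolding G_def by (rule prod.distrib[symmetric])
  have int_GG: "integrable Q (\<lambda>\<omega>. G \<beta> \<omega> * G \<beta>' \<omega>)" if "\<beta> \<in> B" "\<beta>' \<in> B" for \<beta> \<beta>'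
    unfolding GG Q_def using int_LL[OF that] by (intro PP.product_integrable_prod) auto
  have G2: "(\<integral>\<omega>. G \<beta> \<omega> * G \<beta>' \<omega> \<partial>Q) \<le> exp (n * s * (\<Sum>k\<in>\<Lambda>. \<beta> k * \<beta>' k))"
    if "\<beta> \<in> B" "\<beta>' \<in> B" for \<beta> \<beta>'
  proof -
    let ?t = "s * (\<Sum>k\<in>\<Lambda>. \<beta> k * \<beta>' k)"
    have "(\<integral>\<omega>. G \<beta> \<omega> * G \<beta>' \<omega> \<partial>Q) = (1 + ?t) ^ n"
      unfolding GG Q_def using int_LL[OF that] LL[OF that] by (subst PP.product_integral_prod) auto
    also have "\<dots> \<le> exp ?t ^ n"
    \<comment> \<open>the base is an integral of a nonnegative function, hence nonnegative\<close>
    proof (rule power_mono)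
      have "0 \<le> (\<integral>z. L \<beta> z * L \<beta>' z \<partial>P)"
        using L_bd(1)[OF that(1)] L_bd(1)[OF that(2)] by (intro integral_nonneg_AE AE_I2) auto
      then show "0 \<le> 1 + ?t" using LL[OF that] by simp
    qed (rule exp_ge_add_one_self)
    also have "\<dots> = exp (n * s * (\<Sum>k\<in>\<Lambda>. \<beta> k * \<beta>' k))"
      by (simp add: exp_of_nat_mult[symmetric] mult.assoc)
    finally show ?thesis .
  qed
  have D2: "(D \<omega>)\<^sup>2 = (\<Sum>\<beta>\<in>B. \<Sum>\<beta>'\<in>B. G \<beta> \<omega> * G \<beta>' \<omega>) / N\<^sup>2" for \<omega>
    unfolding D_def by (simp add: power2_eq_square sum_product)
  have int_D: "integrable Q D" "integrable Q (\<lambda>\<omega>. (D \<omega>)\<^sup>2)"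
    unfolding D2 unfolding D_def using int_G int_GG by auto
  have ED: "(\<integral>\<omega>. D \<omega> \<partial>Q) = 1"
    unfolding D_def using int_G G1 N by (simp add: Bochner_Integration.integral_sum N_def)
  have "(\<integral>\<omega>. (D \<omega>)\<^sup>2 \<partial>Q) = (\<Sum>\<beta>\<in>B. \<Sum>\<beta>'\<in>B. \<integral>\<omega>. G \<beta> \<omega> * G \<beta>' \<omega> \<partial>Q) / N\<^sup>2"
    unfolding D2 using int_GG by (simp add: Bochner_Integration.integral_sum)
  also have "\<dots> \<le> (\<Sum>\<beta>\<in>B. \<Sum>\<beta>'\<in>B. exp ((n * s) * (\<Sum>k\<in>\<Lambda>. \<beta> k * \<beta>' k))) / N\<^sup>2"
    using G2 N by (intro divide_right_mono sum_mono) auto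
  also have "\<dots> \<le> (N\<^sup>2 * exp (card \<Lambda> * (n * s)\<^sup>2 / 2)) / N\<^sup>2"
    unfolding N_def B_def by (intro divide_right_mono rademacher_exponential_moment[OF \<Lambda>]) auto
  finally have ED2: "(\<integral>\<omega>. (D \<omega>)\<^sup>2 \<partial>Q) \<le> exp (card \<Lambda> * (n * s)\<^sup>2 / 2)" using N by simp
  have sQ: "sets Q = sets (\<Pi>\<^sub>M i\<in>{..<n}. obs_space)"
    unfolding Q_def by (intro sets_PiM_cong refl sP)
  have \<phi>Q: "\<phi> \<in> Q \<rightarrow>\<^sub>M count_space {0, 1}"
    using \<phi> unfolding tests_def measurable_cong_sets[OF sQ refl] .
  have A: "A \<in> sets Q"
    using measurable_sets[OF \<phi>Q, of "{1}"] unfolding A_def by (simp add: vimage_def Int_def conj_commute)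
  have cA: "{\<omega> \<in> space Q. \<phi> \<omega> = 0} = space Q - A"
    using measurable_space[OF \<phi>Q] unfolding A_def by auto
  have err: "?err \<beta> = ennreal (\<integral>\<omega>. G \<beta> \<omega> * indicator (space Q - A) \<omega> \<partial>Q)" if \<beta>: "\<beta> \<in> B" for \<beta>
  proof -
    have dens: "pair_law (\<lambda>x. c + h \<beta> x) (\<lambda>_. 1) = density P (L \<beta>)"
      unfolding P_def L_def using hc[OF \<beta>] by (intro pair_law_eq_density c mh) auto
    have "0 \<le> c + h \<beta> x \<and> c + h \<beta> x \<le> 1" if "x \<in> cbox 0 1" for x
      using hc[OF \<beta> that] c by linarith
    then have "prob_space (density P (L \<beta>))"
      unfolding dens[symmetric] using mh by (intro prob_space_pair_law) auto
    then have "sample_law n (\<lambda>x. c + h \<beta> x) (\<lambda>_. 1) = density Q (\<lambda>\<omega>. \<Prod>i<n. ennreal (L \<beta> (\<omega> i)))"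
      unfolding sample_law_def dens Q_def by (intro density_PiM P.prob_space_axioms) auto
    also have "\<dots> = density Q (\<lambda>\<omega>. ennreal (G \<beta> \<omega>))"
    proof (intro density_cong AE_I2)
      fix \<omega> assume "\<omega> \<in> space Q"
      then have "\<And>i. i < n \<Longrightarrow> \<omega> i \<in> space P" unfolding Q_def by (auto simp: space_PiM)
      then show "(\<Prod>i<n. ennreal (L \<beta> (\<omega> i))) = ennreal (G \<beta> \<omega>)"
        unfolding G_def using L_bd(1)[OF \<beta>] by (intro prod_ennreal) auto
    qed (auto simp: G_def Q_def)
    finally have law: "sample_law n (\<lambda>x. c + h \<beta> x) (\<lambda>_. 1) = density Q (\<lambda>\<omega>. ennreal (G \<beta> \<omega>))" .
    have Gpos: "0 \<le> G \<beta> \<omega>" if "\<omega> \<in> space Q" for \<omega>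
      using that unfolding G_def Q_def by (intro prod_nonneg L_bd(1)[OF \<beta>]) (auto simp: space_PiM)
    have "?err \<beta> = emeasure (density Q (\<lambda>\<omega>. ennreal (G \<beta> \<omega>))) (space Q - A)"
      unfolding h_def[symmetric] law by (simp add: cA)
    also have "\<dots> = (\<integral>\<^sup>+\<omega>. ennreal (G \<beta> \<omega>) * indicator (space Q - A) \<omega> \<partial>Q)"
      using A int_G[OF \<beta>] by (intro emeasure_density) auto
    also have "\<dots> = (\<integral>\<^sup>+\<omega>. ennreal (G \<beta> \<omega> * indicator (space Q - A) \<omega>) \<partial>Q)"
      by (intro nn_integral_cong) (auto split: split_indicator)
    also have "\<dots> = ennreal (\<integral>\<omega>. G \<beta> \<omega> * indicator (space Q - A) \<omega> \<partial>Q)"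
      using A int_G[OF \<beta>] Gpos
      by (intro nn_integral_eq_integral integrable_real_mult_indicator AE_I2) (auto split: split_indicator)
    finally show ?thesis .
  qed
  have "1 - sqrt (exp (card \<Lambda> * (n * s)\<^sup>2 / 2) - 1) \<le> 1 - sqrt ((\<integral>\<omega>. (D \<omega>)\<^sup>2 \<partial>Q) - 1)"
    using ED2 by simp
  also have "\<dots> \<le> measure Q A + (\<integral>\<omega>. D \<omega> * indicator (space Q - A) \<omega> \<partial>Q)"
    by (rule Q.chi_square_testing_bound[OF int_D ED A])
  also have "(\<integral>\<omega>. D \<omega> * indicator (space Q - A) \<omega> \<partial>Q)
      = (\<Sum>\<beta>\<in>B. (\<integral>\<omega>. G \<beta> \<omega> * indicator (space Q - A) \<omega> \<partial>Q)) / N"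
  proof -
    have "integrable Q (\<lambda>\<omega>. G \<beta> \<omega> * indicator (space Q - A) \<omega>)" if "\<beta> \<in> B" for \<beta>
      using A int_G[OF that] by (intro integrable_real_mult_indicator) auto
    then show ?thesis
      unfolding D_def by (simp add: sum_distrib_right Bochner_Integration.integral_sum)
  qed
  finally have real_bd: "1 - sqrt (exp (card \<Lambda> * (n * s)\<^sup>2 / 2) - 1)
     \<le> measure Q A + (\<Sum>\<beta>\<in>B. (\<integral>\<omega>. G \<beta> \<omega> * indicator (space Q - A) \<omega> \<partial>Q)) / N" .
  have Ipos: "0 \<le> (\<integral>\<omega>. G \<beta> \<omega> * indicator (space Q - A) \<omega> \<partial>Q)" if "\<beta> \<in> B" for \<beta>
  proof (intro integral_nonneg_AE AE_I2)
    fix \<omega> assume "\<omega> \<in> space Q"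
    then show "0 \<le> G \<beta> \<omega> * indicator (space Q - A) \<omega>"
      unfolding G_def Q_def
      by (intro mult_nonneg_nonneg prod_nonneg L_bd(1)[OF that]) (auto simp: space_PiM)
  qed
  have "ennreal (1 - sqrt (exp (card \<Lambda> * (n * s)\<^sup>2 / 2) - 1))
     \<le> emeasure Q A + ennreal ((\<Sum>\<beta>\<in>B. (\<integral>\<omega>. G \<beta> \<omega> * indicator (space Q - A) \<omega> \<partial>Q)) / N)"
    unfolding Q.emeasure_eq_measure using real_bd Ipos N
    by (subst ennreal_plus[symmetric]) (auto intro!: ennreal_leI divide_nonneg_pos sum_nonneg)
  also have "\<dots> = emeasure Q A + (\<Sum>\<beta>\<in>B. ?err \<beta>) / ennreal N"
    using Ipos N err by (simp add: divide_ennreal[symmetric] sum_nonneg flip: sum_ennreal)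
  also have "(\<Sum>\<beta>\<in>B. ?err \<beta>) \<le> (\<Sum>\<beta>\<in>B. (SUP \<beta>\<in>B. ?err \<beta>))"
    by (intro sum_mono SUP_upper)
  also have "\<dots> = ennreal N * (SUP \<beta>\<in>B. ?err \<beta>)" by (simp add: N_def ennreal_of_nat_eq_real_of_nat)
  also have "\<dots> / ennreal N = (SUP \<beta>\<in>B. ?err \<beta>)"
    using N by (subst mult.commute) (simp add: ennreal_mult_divide_eq)
  finally show ?thesis
    by (auto simp: A_def Q_def P_def s_def sample_law_def divide_right_mono_ennreal add_left_mono)
qed

section \<open>Wavelet detail spaces and Besov balls\<close>

lemma hoelder_zygmund_bounded:
  assumes "hoelder_zygmund s f" shows "bounded (range f)"
proof -
  have "\<forall>i\<le>nat \<lceil>s\<rceil> - 1. bounded (range ((deriv ^^ i) f))"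
    using assms unfolding hoelder_zygmund_def Let_def by auto
  from this[rule_format, of 0] show ?thesis by simp
qed

lemma sum_abs_le_if_at_most_one_nonzero:
  fixes g :: "'a \<Rightarrow> real"
  assumes I: "finite I" and C: "C \<ge> 0" "\<And>k. k \<in> I \<Longrightarrow> \<bar>g k\<bar> \<le> C"
    and one: "\<And>k k'. k \<in> I \<Longrightarrow> k' \<in> I \<Longrightarrow> g k \<noteq> 0 \<Longrightarrow> g k' \<noteq> 0 \<Longrightarrow> k = k'"
  shows "(\<Sum>k\<in>I. \<bar>g k\<bar>) \<le> C"
proof (cases "\<exists>k\<in>I. g k \<noteq> 0")
  case True
  then obtain k where k: "k \<in> I" "g k \<noteq> 0" by blast
  have "(\<Sum>i\<in>I. \<bar>g i\<bar>) = \<bar>g k\<bar> + (\<Sum>i\<in>I - {k}. \<bar>g i\<bar>)" using I k by (rule_tac sum.remove)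
  also have "(\<Sum>i\<in>I - {k}. \<bar>g i\<bar>) = 0" using one k by (intro sum.neutral) auto
  finally show ?thesis using C(2) k by simp
next
  case False then show ?thesis using C(1) by simp
qed

text \<open>A positive fraction of the level-\<open>j\<close> wavelets suffices for the lower bound.  If \<open>2\<^sup>q\<close> exceeds the radius of the support of the
mother wavelet, translates by distinct multiples of \<open>2\<^sup>q\<^sup>+\<^sup>1\<close> never overlap, and the first \<open>2 ^ (j - q - 2)\<close> of
them, starting at \<open>2\<^sup>q\<^sup>+\<^sup>1\<close>, stay in the open unit interval.  At every point at most one of them is nonzero.\<close>

lemma separated_interior_wavelets:
  assumes W: "daubechies_system N R (scal W) (wav W)"
  obtains p :: nat and C :: real where "C > 0"
    "\<And>j. j > p \<Longrightarrow> \<exists>I\<subseteq>wav_idx W j. finite I \<and> card I = 2 ^ (j - p - 1) \<and>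
        (\<forall>y. (\<Sum>k\<in>I. \<bar>wav_fun W j k y\<bar>) \<le> C * 2 powr (real j / 2))"
proof -
  let ?\<psi> = "wav W"
  have hz: "hoelder_zygmund R ?\<psi>" and cs: "compact (fsupp ?\<psi>)"
    using W by (auto simp: daubechies_system_def)
  obtain C0 where C0: "\<And>y. \<bar>?\<psi> y\<bar> \<le> C0"
    using hoelder_zygmund_bounded[OF hz] by (auto simp: bounded_iff)
  define C where "C = C0 + 1"
  have C: "C > 0" "\<bar>?\<psi> y\<bar> \<le> C" for y
    using C0[of 0] C0[of y] abs_ge_zero[of "?\<psi> 0"] unfolding C_def by linarith+
  obtain A where A: "\<And>y. y \<in> fsupp ?\<psi> \<Longrightarrow> \<bar>y\<bar> \<le> A"
    using compact_imp_bounded[OF cs] by (auto simp: bounded_iff)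
  obtain q :: nat where q: "A < 2 ^ q" using real_arch_pow[of 2 A] by auto
  have supp: "\<bar>y\<bar> \<le> A" if "?\<psi> y \<noteq> 0" for y
    using that A closure_subset[of "{x. ?\<psi> x \<noteq> 0}"] unfolding fsupp_def by blast
  \<comment> \<open>the spacing \<open>2 ^ (q + 1)\<close> of the translates exceeds the diameter of the support\<close>
  show thesis
  proof (rule that[of C "q + 1"], goal_cases)
    case (2 j)
    define \<kappa> where "\<kappa> i = Inner (2 ^ (q + 1) * (int i + 1))" for i
    define I where "I = \<kappa> ` {..<2 ^ (j - (q + 1) - 1)}"
    have inj: "inj \<kappa>" by (auto simp: inj_def \<kappa>_def)
    have val: "wav_fun W j (\<kappa> i) y = 2 powr (real j / 2) * ?\<psi> (2 ^ j * y - 2 ^ (q + 1) * (real i + 1))" for i y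
      by (simp add: wav_fun_def \<kappa>_def dilate_def)
    have "I \<subseteq> wav_idx W j"
    proof
      fix k assume "k \<in> I"
      then obtain i where i: "i < 2 ^ (j - (q + 1) - 1)" "k = \<kappa> i" by (auto simp: I_def)
      have "fsupp (dilate ?\<psi> j (2 ^ (q + 1) * (int i + 1))) \<subseteq> {x. \<bar>2 ^ j * x - 2 ^ (q + 1) * (real i + 1)\<bar> \<le> A}"
        unfolding fsupp_def
      proof (rule closure_minimal)
        show "{x. dilate ?\<psi> j (2 ^ (q + 1) * (int i + 1)) x \<noteq> 0}
           \<subseteq> {x. \<bar>2 ^ j * x - 2 ^ (q + 1) * (real i + 1)\<bar> \<le> A}"
          using supp by (auto simp: dilate_def)
        show "closed {x. \<bar>2 ^ j * x - 2 ^ (q + 1) * (real i + 1)\<bar> \<le> A}"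
          by (intro closed_Collect_le continuous_intros)
      qed
      also have "\<dots> \<subseteq> {0<..<1}"
      proof
        fix x assume "x \<in> {x. \<bar>2 ^ j * x - 2 ^ (q + 1) * (real i + 1)\<bar> \<le> A}"
        then have x: "2 ^ (q + 1) * (real i + 1) - A \<le> 2 ^ j * x" "2 ^ j * x \<le> 2 ^ (q + 1) * (real i + 1) + A"
          by auto
        have "2 ^ (q + 1) * 1 \<le> 2 ^ (q + 1) * (real i + 1)" by (intro mult_left_mono) auto
        moreover have "(2::real) ^ (q + 1) = 2 * 2 ^ q" by simp
        moreover have "(0::real) < 2 ^ q" by simp
        ultimately have "0 < 2 ^ j * x" using x(1) q by linarith
        then have "0 < x" by (simp add: zero_less_mult_iff)
        have "real i + 1 \<le> 2 ^ (j - (q + 1) - 1)" using i(1)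
          by (metis Suc_eq_plus1 Suc_leI of_nat_1 of_nat_add of_nat_le_iff of_nat_numeral of_nat_power)
        then have "2 ^ (q + 1) * (real i + 1) \<le> 2 ^ (q + 1) * 2 ^ (j - (q + 1) - 1)"
          by (intro mult_left_mono) auto
        also have "\<dots> = 2 ^ (j - 1)" using 2 unfolding power_add[symmetric] by (intro arg_cong[where f="(^) 2"]) simp
        finally have "2 ^ (q + 1) * (real i + 1) \<le> 2 ^ (j - 1)" .
        moreover have "(2::real) ^ q \<le> 2 ^ (j - 1)" using 2 by (intro power_increasing) auto
        moreover have "(2::real) ^ j = 2 * 2 ^ (j - 1)" using 2 by (cases j) auto
        ultimately have "2 ^ j * x < 2 ^ j * 1" using x(2) q by linarith
        then have "x < 1" by (simp only: mult_less_cancel_left_pos zero_less_power zero_less_numeral)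
        with \<open>0 < x\<close> show "x \<in> {0<..<1}" by simp
      qed
      finally show "k \<in> wav_idx W j" unfolding i(2) \<kappa>_def wav_idx_def interval_idx_def by auto
    qed
    moreover have "card I = 2 ^ (j - (q + 1) - 1)"
      unfolding I_def using inj by (subst card_image) (auto intro: inj_on_subset)
    moreover have "(\<Sum>k\<in>I. \<bar>wav_fun W j k y\<bar>) \<le> C * 2 powr (real j / 2)" for y
    proof (rule sum_abs_le_if_at_most_one_nonzero)
      fix k assume "k \<in> I"
      then obtain i where i: "k = \<kappa> i" by (auto simp: I_def)
      show "\<bar>wav_fun W j k y\<bar> \<le> C * 2 powr (real j / 2)"
        unfolding i val using C(2) by (simp add: abs_mult mult.commute mult_left_mono)
    next
      fix k k' assume "k \<in> I" "k' \<in> I" and nz: "wav_fun W j k y \<noteq> 0" "wav_fun W j k' y \<noteq> 0"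
      then obtain i i' where i: "k = \<kappa> i" "k' = \<kappa> i'" by (auto simp: I_def)
      have "\<bar>2 ^ j * y - 2 ^ (q + 1) * (real i + 1)\<bar> < 2 ^ q" "\<bar>2 ^ j * y - 2 ^ (q + 1) * (real i' + 1)\<bar> < 2 ^ q"
        using nz supp q unfolding i val by fastforce+
      then have "\<bar>2 ^ (q + 1) * (real i + 1) - 2 ^ (q + 1) * (real i' + 1)\<bar> < 2 ^ (q + 1) * 1"
        by (simp only: power_add power_one_right)
      then have "2 ^ (q + 1) * \<bar>real i - real i'\<bar> < 2 ^ (q + 1) * 1"
        by (simp add: abs_mult flip: right_diff_distrib)
      then have "\<bar>real i - real i'\<bar> < 1" by (simp only: mult_less_cancel_left_pos zero_less_power zero_less_numeral)
      then have "i = i'" by linarith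
      then show "k = k'" using i by simp
    qed (use C in \<open>auto simp: I_def\<close>)
    ultimately show ?case by (intro exI[of _ I]) (auto simp: I_def)
  qed (rule C(1))
qed

locale cdv =
  fixes W :: cdv_data and N :: nat and R :: real
  assumes sys: "cdv_system N R W"
begin

abbreviation J0 where "J0 \<equiv> base_level W"

lemma level_facts:
  assumes "j \<ge> J0"
  shows "finite (scal_idx W j)"
    and "l2_orthonormal unit_interval (scal_idx W j) (scal_fun W j)"
    and "l2_orthonormal unit_interval (wav_idx W j) (wav_fun W j)"
    and "l2_orth_sum unit_interval (V_int W (Suc j)) (V_int W j) (W_int W j)"
    and "(\<lambda>_. 1) \<in> V_int W j"
proof -
  have c: "card (scal_idx W j) = 2 ^ j"
    and *: "l2_orthonormal unit_interval (scal_idx W j) (scal_fun W j)"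
     "l2_orthonormal unit_interval (wav_idx W j) (wav_fun W j)"
     "l2_orth_sum unit_interval (V_int W (Suc j)) (V_int W j) (W_int W j)"
     "\<And>p. degree p \<le> N - 1 \<Longrightarrow> poly p \<in> V_int W j"
    using sys assms unfolding cdv_system_def by blast+
  show "finite (scal_idx W j)" using c by (intro card_ge_0_finite) simp
  show "l2_orthonormal unit_interval (scal_idx W j) (scal_fun W j)"
    "l2_orthonormal unit_interval (wav_idx W j) (wav_fun W j)"
    "l2_orth_sum unit_interval (V_int W (Suc j)) (V_int W j) (W_int W j)" by fact+
  have "poly [:1:] \<in> V_int W j" by (rule *(4)) simp
  moreover have "poly [:1:] = (\<lambda>_. 1 :: real)" by (simp add: fun_eq_iff)
  ultimately show "(\<lambda>_. 1) \<in> V_int W j" by simp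
qed

lemma scal_fun_l2: "j \<ge> J0 \<Longrightarrow> i \<in> scal_idx W j \<Longrightarrow> scal_fun W j i \<in> l2_set unit_interval"
  using level_facts(2) by (auto simp: l2_orthonormal_def)

lemma wav_fun_l2: "j \<ge> J0 \<Longrightarrow> i \<in> wav_idx W j \<Longrightarrow> wav_fun W j i \<in> l2_set unit_interval"
  using level_facts(3) by (auto simp: l2_orthonormal_def)

lemma scal_fun_V: "j \<ge> J0 \<Longrightarrow> i \<in> scal_idx W j \<Longrightarrow> scal_fun W j i \<in> V_int W j"
  unfolding V_int_def by (intro l2_span_base) (auto simp: scal_fun_l2)

lemma wav_fun_W: "j \<ge> J0 \<Longrightarrow> i \<in> wav_idx W j \<Longrightarrow> wav_fun W j i \<in> W_int W j"
  unfolding W_int_def by (intro l2_span_base) (auto simp: wav_fun_l2)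

lemma scal_fun_V_Suc:
  assumes "j \<ge> J0" "i \<in> scal_idx W j" shows "scal_fun W j i \<in> V_int W (Suc j)"
proof -
  have "(\<lambda>_. 0) \<in> W_int W j" unfolding W_int_def by (rule l2_span_zero)
  then show ?thesis
    using level_facts(4)[OF assms(1)] scal_fun_V[OF assms] scal_fun_l2[OF assms]
    unfolding l2_orth_sum_def
    by (simp, intro bexI[of _ "scal_fun W j i"] bexI[of _ "\<lambda>_. 0"]) simp_all
qed

lemma wav_fun_V_Suc:
  assumes "j \<ge> J0" "i \<in> wav_idx W j" shows "wav_fun W j i \<in> V_int W (Suc j)"
proof -
  have "(\<lambda>_. 0) \<in> V_int W j" unfolding V_int_def by (rule l2_span_zero)
  then show ?thesis
    using level_facts(4)[OF assms(1)] wav_fun_W[OF assms] wav_fun_l2[OF assms]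
    unfolding l2_orth_sum_def
    by (simp, intro bexI[of _ "\<lambda>_. 0"] bexI[of _ "wav_fun W j i"]) simp_all
qed

lemma scal_wav_orth:
  assumes "j \<ge> J0" "i \<in> scal_idx W j" "i' \<in> wav_idx W j"
  shows "l2_inner unit_interval (wav_fun W j i') (scal_fun W j i) = 0"
  using level_facts(4)[OF assms(1)] scal_fun_V[OF assms(1,2)] wav_fun_W[OF assms(1,3)]
  unfolding l2_orth_sum_def by (subst l2_inner_commute) blast

lemma scal_tensor_eq: "scal_tensor W j = (\<lambda>\<kappa> (x::real^'d). \<Prod>l\<in>UNIV. scal_fun W j (\<kappa> l) (x $ l))"
  by (intro ext) (simp add: scal_tensor_def)

lemma scal_tensor_orthonormal:
  assumes "j \<ge> J0"
  shows "l2_orthonormal unit_cube {\<kappa>. \<forall>l. \<kappa> l \<in> scal_idx W j} (scal_tensor W j :: _ \<Rightarrow> real^'d \<Rightarrow> real)"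
  unfolding scal_tensor_eq by (rule l2_orthonormal_tensor[OF level_facts(2)[OF assms]])

text \<open>Lifts membership from one dimension to the cube, which gives the constants, the nesting of the spaces and the
position of the tensor wavelets.\<close>

lemma tensor_V_cube:
  fixes u :: "'d::finite \<Rightarrow> real \<Rightarrow> real"
  assumes "j \<ge> J0" "\<And>l. u l \<in> V_int W j"
  shows "(\<lambda>x. \<Prod>l\<in>UNIV. u l (x $ l)) \<in> V_cube W j"
  unfolding V_cube_def scal_tensor_eq
  using assms scal_fun_l2 by (intro l2_span_tensor) (auto simp: V_int_def)

lemma V_cube_l2: "V_cube W j \<subseteq> l2_set (unit_cube :: (real^'d) measure)"
  unfolding V_cube_def by (rule l2_span_subset)

lemma const_V_cube: "j \<ge> J0 \<Longrightarrow> (\<lambda>_::real^'d. c) \<in> V_cube W j"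
proof -
  assume j: "j \<ge> J0"
  have "(\<lambda>x::real^'d. \<Prod>l\<in>(UNIV::'d set). 1) \<in> V_cube W j"
    using tensor_V_cube[of j "\<lambda>_::'d. \<lambda>_. 1"] j level_facts(5) by auto
  then have "(\<lambda>x::real^'d. c * 1) \<in> V_cube W j"
    unfolding V_cube_def by (intro l2_span_scale) simp
  then show ?thesis by simp
qed

lemma V_cube_mono:
  assumes "J0 \<le> i" "i \<le> j" shows "(V_cube W i :: (real^'d \<Rightarrow> real) set) \<subseteq> V_cube W j"
  using assms(2)
proof (induction j rule: dec_induct)
  case (step j)
  have "(V_cube W j :: (real^'d \<Rightarrow> real) set) \<subseteq> V_cube W (Suc j)"
    unfolding V_cube_def[of W j]  unfolding V_cube_def[of W "Suc j"]
  proof (rule l2_span_subset_span, unfold V_cube_def[symmetric], rule image_subsetI)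
    fix \<kappa> :: "'d \<Rightarrow> bindex" assume "\<kappa> \<in> {\<kappa>. \<forall>l. \<kappa> l \<in> scal_idx W j}"
    then show "scal_tensor W j \<kappa> \<in> V_cube W (Suc j)"
      unfolding scal_tensor_eq using assms step by (intro tensor_V_cube scal_fun_V_Suc) auto
  qed
  with step.IH show ?case by blast
qed simp

lemma P_proj_props:
  fixes h :: "real^'d \<Rightarrow> real"
  assumes "j \<ge> J0" "h \<in> l2_set unit_cube"
  shows "P_proj W j h \<in> V_cube W j"
    and "v \<in> V_cube W j \<Longrightarrow> l2_inner unit_cube (\<lambda>x. h x - P_proj W j h x) v = 0"
proof -
  have "finite {\<kappa> :: 'd \<Rightarrow> bindex. \<forall>l. \<kappa> l \<in> scal_idx W j}"
    using finite_PiE[of UNIV "\<lambda>_::'d. scal_idx W j"] level_facts(1)[OF assms(1)]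
    by (simp add: PiE_UNIV_domain Pi_def)
  note * = l2_proj_orthonormal[OF scal_tensor_orthonormal[OF assms(1)] this assms(2)]
  show "P_proj W j h \<in> V_cube W j"
    unfolding P_proj_def V_cube_def by (rule *(1))
  show "v \<in> V_cube W j \<Longrightarrow> l2_inner unit_cube (\<lambda>x. h x - P_proj W j h x) v = 0"
    unfolding P_proj_def V_cube_def by (rule *(2))
qed

lemma P_proj_AE_eq:
  fixes h :: "real^'d \<Rightarrow> real"
  assumes "h \<in> l2_set unit_cube" "p \<in> V_cube W j"
    and "\<And>v. v \<in> V_cube W j \<Longrightarrow> l2_inner unit_cube (\<lambda>x. h x - p x) v = 0"
  shows "AE x in unit_cube. P_proj W j h x = p x"
  unfolding P_proj_def using assms by (intro l2_proj_AE_unique[OF V_cube_def])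

text \<open>The orthogonal complement of \<open>V\<^sub>j\<close> in \<open>V\<^sub>j\<^sub>+\<^sub>1\<close> on the cube, which is the range of \<open>Q\<^sub>j\<close>.  It also contains tensors that mix
wavelets with scaling functions.\<close>

definition detail :: "nat \<Rightarrow> (real^'d \<Rightarrow> real) set" where
  "detail j = {q \<in> V_cube W (Suc j). \<forall>v\<in>V_cube W j. l2_inner unit_cube q v = 0}"

text \<open>All projections up to level \<open>j\<close> see only the constant and all later ones see the whole function, so only the
increment at level \<open>j\<close> can be nonzero.\<close>

lemma besov_norm_const_plus_detail:
  fixes q :: "real^'d \<Rightarrow> real"
  assumes j: "j \<ge> J0" and q: "q \<in> detail j" and c: "c \<ge> 0"
  shows "besov_norm W u (\<lambda>x. c + q x)
     \<le> ennreal (2 powr (real J0 * u) * c + 2 powr (real j * u) * l2_norm unit_cube q)"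
proof -
  interpret U: prob_space "unit_cube :: (real^'d) measure" by (rule prob_space_unit_cube)
  let ?f = "\<lambda>x. c + q x"
  have ql: "q \<in> l2_set unit_cube" using q V_cube_l2 by (auto simp: detail_def)
  have cl: "(\<lambda>_::real^'d. c) \<in> l2_set unit_cube" by (simp add: l2_set_def)
  have fl: "?f \<in> l2_set unit_cube" by (rule l2_set_add[OF cl ql])
  have low: "AE x in unit_cube. P_proj W m ?f x = c" if "J0 \<le> m" "m \<le> j" for m
    using q that V_cube_mono[OF that, where 'd='d]
    by (intro P_proj_AE_eq fl const_V_cube) (auto simp: detail_def)
  have high: "AE x in unit_cube. P_proj W m ?f x = ?f x" if "j < m" for m
  proof (intro P_proj_AE_eq fl)
    have "q \<in> V_cube W m" using q that V_cube_mono[of "Suc j" m, where 'd='d] j by (auto simp: detail_def)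
    then show "?f \<in> V_cube W m"
      unfolding V_cube_def using const_V_cube[of m c] that j by (intro l2_span_add) (auto simp: V_cube_def)
  qed (simp add: l2_inner_def)
  have Pl: "P_proj W m ?f \<in> l2_set unit_cube" if "J0 \<le> m" for m
    using P_proj_props(1)[OF that fl] V_cube_l2 by blast
  have Ql: "Q_proj W m ?f \<in> l2_set unit_cube" if "J0 \<le> m" for m
    unfolding Q_proj_def using Pl that by (intro l2_set_diff) auto
  have "l2_norm unit_cube (P_proj W J0 ?f) = l2_norm unit_cube (\<lambda>_::real^'d. c)"
    using low[of J0] j by (intro l2_norm_cong_AE Pl cl) auto
  also have "\<dots> = c" using c U.prob_space by (simp add: l2_norm_def)
  finally have n0: "l2_norm unit_cube (P_proj W J0 ?f) = c" .
  have Q: "l2_norm unit_cube (Q_proj W m ?f) = (if m = j then l2_norm unit_cube q else 0)" if m: "J0 \<le> m" for m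
  proof -
    have zero: "l2_norm unit_cube (\<lambda>_::real^'d. 0) = 0" by (simp add: l2_norm_def)
    consider "m < j" | "m = j" | "m > j" by linarith
    then show ?thesis
    proof cases
      case 1
      then have "AE x in unit_cube. Q_proj W m ?f x = 0"
        using low[OF m] low[of "Suc m"] m unfolding Q_proj_def by auto
      then show ?thesis using l2_norm_cong_AE[OF _ Ql[OF m] l2_set_zero] 1 zero by simp
    next
      case 2
      then have "AE x in unit_cube. Q_proj W m ?f x = q x"
        using low[OF m] high[of "Suc m"] m unfolding Q_proj_def by auto
      then show ?thesis using l2_norm_cong_AE[OF _ Ql[OF m] ql] 2 by simp
    next
      case 3
      then have "AE x in unit_cube. Q_proj W m ?f x = 0"
        using high[of m] high[of "Suc m"] m unfolding Q_proj_def by auto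
      then show ?thesis using l2_norm_cong_AE[OF _ Ql[OF m] l2_set_zero] 3 zero by simp
    qed
  qed
  have "(SUP m\<in>{J0..}. ennreal (2 powr (real m * u) * l2_norm unit_cube (Q_proj W m ?f)))
      \<le> ennreal (2 powr (real j * u) * l2_norm unit_cube q)"
    by (intro SUP_least) (auto simp: Q)
  then show ?thesis
    unfolding besov_norm_def n0 using c
    by (subst ennreal_plus) (auto simp: l2_norm_nonneg intro: add_left_mono)
qed

lemma const_mem_besov_ball:
  assumes "c \<ge> 0" "2 powr (real J0 * u) * c \<le> M"
  shows "(\<lambda>_::real^'d. c) \<in> besov_ball W u M"
proof -
  interpret U: prob_space "unit_cube :: (real^'d) measure" by (rule prob_space_unit_cube)
  have "(\<lambda>_::real^'d. 0) \<in> detail J0"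
    using const_V_cube[of "Suc J0" 0] by (simp add: detail_def l2_inner_def)
  from besov_norm_const_plus_detail[OF order_refl this assms(1), of u]
  have "besov_norm W u (\<lambda>_::real^'d. c) \<le> ennreal (2 powr (real J0 * u) * c)"
    by (simp add: l2_norm_def)
  also have "\<dots> \<le> ennreal M" using assms(2) by (rule ennreal_leI)
  finally show ?thesis unfolding besov_ball_def by (simp add: l2_set_def)
qed

text \<open>Test the difference to \<open>g\<close> in the ball against the detail \<open>q\<close> itself.  Only the level-\<open>j\<close>
increment of \<open>g\<close> contributes to the inner product with \<open>q\<close>, and the Besov norm of \<open>g\<close> bounds it; the
Cauchy-Schwarz inequality then gives the distance after division by the norm of \<open>q\<close>.\<close>

lemma l2_dist_besov_ball_ge:
  fixes q :: "real^'d \<Rightarrow> real"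
  assumes j: "j \<ge> J0" and q: "q \<in> detail j" and M: "M \<ge> 0"
    and ne: "(besov_ball W t M :: (real^'d \<Rightarrow> real) set) \<noteq> {}"
  shows "l2_norm unit_cube q - M * 2 powr (- (real j * t))
     \<le> l2_dist_set unit_cube (\<lambda>x. c + q x) (besov_ball W t M)"
  unfolding l2_dist_set_def
proof (rule cINF_greatest[OF ne])
  interpret U: prob_space "unit_cube :: (real^'d) measure" by (rule prob_space_unit_cube)
  fix g :: "real^'d \<Rightarrow> real" assume g: "g \<in> besov_ball W t M"
  let ?nq = "l2_norm unit_cube q"
  have gl: "g \<in> l2_set unit_cube" and gn: "besov_norm W t g \<le> ennreal M"
    using g by (auto simp: besov_ball_def)
  have ql: "q \<in> l2_set unit_cube" using q V_cube_l2 by (auto simp: detail_def)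
  have cl: "(\<lambda>_::real^'d. c) \<in> l2_set unit_cube" by (simp add: l2_set_def)
  have fgl: "(\<lambda>x. c + q x - g x) \<in> l2_set unit_cube"
    by (intro l2_set_diff l2_set_add cl ql gl)
  have Pl: "P_proj W m g \<in> l2_set unit_cube" if "J0 \<le> m" for m
    using P_proj_props(1)[OF that gl] V_cube_l2 by blast
  have Ql: "Q_proj W j g \<in> l2_set unit_cube"
    unfolding Q_proj_def using Pl j by (intro l2_set_diff) auto
  have "ennreal (2 powr (real j * t) * l2_norm unit_cube (Q_proj W j g)) \<le> besov_norm W t g"
    unfolding besov_norm_def using j by (intro add_increasing SUP_upper) auto
  also note gn
  finally have "ennreal (2 powr (real j * t) * l2_norm unit_cube (Q_proj W j g)) \<le> ennreal M" .
  then have "2 powr (real j * t) * l2_norm unit_cube (Q_proj W j g) \<le> M"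
    using M by (simp add: ennreal_le_iff)
  then have Qn: "l2_norm unit_cube (Q_proj W j g) \<le> M * 2 powr (- (real j * t))"
    by (simp add: powr_minus field_simps)
  have "l2_inner unit_cube g q = l2_inner unit_cube (P_proj W (Suc j) g) q"
    using P_proj_props(2)[OF _ gl, of "Suc j" q] q j l2_inner_diff_left[OF gl Pl ql, of "Suc j"]
    by (simp add: detail_def)
  also have "\<dots> = l2_inner unit_cube (P_proj W (Suc j) g) q - l2_inner unit_cube (P_proj W j g) q"
    using q P_proj_props(1)[OF j gl] l2_inner_commute[of unit_cube "P_proj W j g" q]
    by (simp add: detail_def)
  also have "\<dots> = l2_inner unit_cube (Q_proj W j g) q"
    unfolding Q_proj_def using Pl j ql by (intro l2_inner_diff_left[symmetric]) auto
  finally have gq: "l2_inner unit_cube g q = l2_inner unit_cube (Q_proj W j g) q" .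
  have cq: "l2_inner unit_cube (\<lambda>_. c) q = 0"
    using q const_V_cube[OF j, of c, where 'd='d] l2_inner_commute[of unit_cube "\<lambda>_. c" q] by (simp add: detail_def)
  have "?nq * ?nq = l2_inner unit_cube (\<lambda>x. c + q x) q"
    using l2_norm_power2[of unit_cube q] l2_inner_add_left[OF cl ql ql] cq by (simp add: power2_eq_square)
  also have "\<dots> = l2_inner unit_cube (\<lambda>x. c + q x - g x) q + l2_inner unit_cube (Q_proj W j g) q"
    using l2_inner_diff_left[OF l2_set_add[OF cl ql] gl ql] gq by simp
  also have "\<dots> \<le> l2_norm unit_cube (\<lambda>x. c + q x - g x) * ?nq + l2_norm unit_cube (Q_proj W j g) * ?nq"
    using l2_cauchy_schwarz[OF fgl ql] l2_cauchy_schwarz[OF Ql ql] by linarith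
  also have "\<dots> \<le> l2_norm unit_cube (\<lambda>x. c + q x - g x) * ?nq + M * 2 powr (- (real j * t)) * ?nq"
    using Qn by (intro add_left_mono mult_right_mono l2_norm_nonneg)
  finally have "?nq * ?nq \<le> (l2_norm unit_cube (\<lambda>x. c + q x - g x) + M * 2 powr (- (real j * t))) * ?nq"
    by (simp add: distrib_right)
  then show "?nq - M * 2 powr (- (real j * t)) \<le> l2_norm unit_cube (\<lambda>x. c + q x - g x)"
  proof (cases "?nq = 0")
    case True
    moreover have "0 \<le> M * 2 powr (- (real j * t))" using M by simp
    ultimately show ?thesis using l2_norm_nonneg[of unit_cube "\<lambda>x. c + q x - g x"] by linarith
  next
    case False
    then have "?nq > 0" using l2_norm_nonneg[of unit_cube q] by linarith
    with \<open>?nq * ?nq \<le> _\<close> show ?thesis by (simp add: mult_le_cancel_right)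
  qed
qed

text \<open>Against a tensor of scaling functions the inner product factorizes into inner products of wavelets with scaling
functions of the same level, each of which vanishes.\<close>

lemma wavelet_tensor_detail:
  assumes j: "j \<ge> J0" and I: "I \<subseteq> wav_idx W j"
  defines "\<Lambda> \<equiv> {\<kappa> :: 'd \<Rightarrow> bindex. \<forall>l. \<kappa> l \<in> I}"
    and "e \<equiv> (\<lambda>\<kappa> (x::real^'d). \<Prod>l\<in>UNIV. wav_fun W j (\<kappa> l) (x $ l))"
  shows "l2_orthonormal unit_cube \<Lambda> e"
    and "(\<lambda>x. \<gamma> * (\<Sum>\<kappa>\<in>\<Lambda>. \<beta> \<kappa> * e \<kappa> x)) \<in> detail j"
proof -
  have "l2_orthonormal unit_interval I (wav_fun W j)"
    using level_facts(3)[OF j] I unfolding l2_orthonormal_def by blast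
  then show on: "l2_orthonormal unit_cube \<Lambda> e"
    unfolding \<Lambda>_def e_def by (rule l2_orthonormal_tensor)
  have el: "e \<kappa> \<in> l2_set unit_cube" if "\<kappa> \<in> \<Lambda>" for \<kappa> using on that by (auto simp: l2_orthonormal_def)
  have eV: "e \<kappa> \<in> V_cube W (Suc j)" if "\<kappa> \<in> \<Lambda>" for \<kappa>
    unfolding e_def using that j I by (intro tensor_V_cube wav_fun_V_Suc) (auto simp: \<Lambda>_def)
  have orth: "l2_inner unit_cube (e \<kappa>) v = 0" if k: "\<kappa> \<in> \<Lambda>" and v: "v \<in> V_cube W j" for \<kappa> v
  proof (rule l2_inner_span_zero[OF el[OF k] _ _ v[unfolded V_cube_def]])
    show "scal_tensor W j ` {\<kappa>. \<forall>l. \<kappa> l \<in> scal_idx W j} \<subseteq> l2_set (unit_cube :: (real^'d) measure)"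
      using scal_tensor_orthonormal[OF j, where 'd='d] by (auto simp: l2_orthonormal_def)
    fix b :: "real^'d \<Rightarrow> real" assume "b \<in> scal_tensor W j ` {\<kappa>. \<forall>l. \<kappa> l \<in> scal_idx W j}"
    then obtain \<kappa>' where k': "\<And>l. \<kappa>' l \<in> scal_idx W j" "b = scal_tensor W j \<kappa>'" by blast
    have kw: "\<And>l. \<kappa> l \<in> wav_idx W j" using k I by (auto simp: \<Lambda>_def)
    have "l2_inner unit_cube (e \<kappa>) b
       = (\<Prod>l\<in>(UNIV :: 'd set). l2_inner unit_interval (wav_fun W j (\<kappa> l)) (scal_fun W j (\<kappa>' l)))"
      unfolding e_def k'(2) scal_tensor_eq
      by (rule l2_inner_tensor) (use j kw k' in \<open>auto intro: wav_fun_l2 scal_fun_l2\<close>)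
    also have "\<dots> = 0" using scal_wav_orth[OF j k'(1) kw] by simp
    finally show "l2_inner unit_cube (e \<kappa>) b = 0" .
  qed
  have "(\<lambda>x. \<gamma> * (\<Sum>\<kappa>\<in>\<Lambda>. \<beta> \<kappa> * e \<kappa> x)) \<in> V_cube W (Suc j)"
    using eV unfolding V_cube_def by (intro l2_span_scale l2_span_lincomb)
  moreover have "l2_inner unit_cube (\<lambda>x. \<gamma> * (\<Sum>\<kappa>\<in>\<Lambda>. \<beta> \<kappa> * e \<kappa> x)) v = 0" if v: "v \<in> V_cube W j" for v
    unfolding l2_inner_scale_left
    using v V_cube_l2 el orth[OF _ v] by (subst l2_inner_lincomb_left) auto
  ultimately show "(\<lambda>x. \<gamma> * (\<Sum>\<kappa>\<in>\<Lambda>. \<beta> \<kappa> * e \<kappa> x)) \<in> detail j"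
    by (simp add: detail_def)
qed

end

section \<open>Alternatives at a fixed resolution level\<close>

abbreviation (input) error_sum ::
    "nat \<Rightarrow> (real ^ 'd \<Rightarrow> real) \<Rightarrow> (real ^ 'd \<Rightarrow> real) set \<Rightarrow>
      ((nat \<Rightarrow> (real ^ 'd) \<times> bool) \<Rightarrow> nat) \<Rightarrow> ennreal" where
  "error_sum n f\<^sub>0 F \<phi> \<equiv>
     emeasure (sample_law n f\<^sub>0 (\<lambda>_. 1)) {\<omega> \<in> space (sample_law n f\<^sub>0 (\<lambda>_. 1)). \<phi> \<omega> = 1} +
     (SUP f\<in>F. emeasure (sample_law n f (\<lambda>_. 1)) {\<omega> \<in> space (sample_law n f (\<lambda>_. 1)). \<phi> \<omega> = 0})"

context cdv begin

text \<open>The lower bound at a fixed sample size and level.  With \<open>K\<close> wavelets and amplitude \<open>\<gamma> = (M / 2) 2\<^sup>-\<^sup>j\<^sup>r / sqrt K\<close> the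
perturbation has norm \<open>(M / 2) 2\<^sup>-\<^sup>j\<^sup>r\<close>.  As \<open>K\<close> is of order \<open>2\<^sup>j\<^sup>d\<close>, the exponent \<open>K (n \<gamma>\<^sup>2)\<^sup>2\<close> in the second moment is of
order \<open>n\<^sup>2 2 powr (- j (4 r + d))\<close>.  The threshold \<open>J1\<close> absorbs three conditions beyond \<open>j \<ge> J0\<close>: the sup norm of the
perturbation is at most \<open>c\<close>, the term \<open>M 2\<^sup>-\<^sup>j\<^sup>t\<close> is at most half of the norm of the perturbation, and
enough interior wavelets exist.\<close>

lemma rademacher_alternatives:
  fixes S r t M c :: real
  assumes S: "S > 0" "0 < r" "r < t" "t < S" "M > 0"
    and c: "0 < c" "c \<le> 1/2" "2 powr (real J0 * S) * c \<le> M / 2"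
  obtains J1 :: nat and C :: real where "C > 0"
    "\<And>j n \<phi> \<epsilon>. j \<ge> J1 \<Longrightarrow> \<phi> \<in> tests n \<Longrightarrow> \<epsilon> \<le> M / 4 * 2 powr (- (real j * r)) \<Longrightarrow>
      ennreal (1 - sqrt (exp (C * (real n)\<^sup>2 * 2 powr (- (real j * (4 * r + real CARD('d))))) - 1)) \<le>
        error_sum n (\<lambda>_::real^'d. c)
          {f \<in> regression_class W r M. l2_dist_set unit_cube f (besov_ball W t M) \<ge> \<epsilon>} \<phi>"
proof -
  let ?d = "CARD('d)"
  have "daubechies_system N R (scal W) (wav W)" using sys by (simp add: cdv_system_def)
  then obtain p :: nat and A :: real where A: "A > 0" and block:
    "\<And>j. j > p \<Longrightarrow> \<exists>I\<subseteq>wav_idx W j. finite I \<and> card I = 2 ^ (j - p - 1) \<and>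
        (\<forall>y. (\<Sum>k\<in>I. \<bar>wav_fun W j k y\<bar>) \<le> A * 2 powr (real j / 2))"
    by (rule separated_interior_wavelets) blast
  define b where "b = M / 2"
  have b: "b > 0" using S by (simp add: b_def)
  define D where "D = b * A ^ ?d * 2 powr (real (p + 1) * real ?d / 2)"
  define C where "C = b ^ 4 * 2 powr (real (p + 1) * real ?d) / (c * (1 - c))\<^sup>2 / 2"
  have C: "C > 0" using b c by (simp add: C_def)
  have "\<forall>\<^sub>F j in sequentially. D * (2 powr (- r)) ^ j < c"
  proof (rule order_tendstoD(2))
    have "(\<lambda>j. D * (2 powr (- r)) ^ j) \<longlonglongrightarrow> D * 0"
      using S by (intro tendsto_mult_left LIMSEQ_realpow_zero) (auto simp: powr_less_one)
    then show "(\<lambda>j. D * (2 powr (- r)) ^ j) \<longlonglongrightarrow> 0" by simp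
  qed (rule c(1))
  moreover have "\<forall>\<^sub>F j in sequentially. (2 powr (- (t - r))) ^ j < 1 / 4"
    using S by (intro order_tendstoD(2)[OF LIMSEQ_realpow_zero]) (auto simp: powr_less_one)
  moreover have "\<forall>\<^sub>F j in sequentially. J0 \<le> j \<and> p < j"
    by (intro eventually_conj eventually_ge_at_top eventually_gt_at_top)
  ultimately have "\<forall>\<^sub>F j in sequentially. D * (2 powr (- r)) ^ j < c \<and> (2 powr (- (t - r))) ^ j < 1 / 4 \<and> J0 \<le> j \<and> p < j"
    by eventually_elim simp
  then obtain J1 where J1: "\<And>j. j \<ge> J1 \<Longrightarrow> D * (2 powr (- r)) ^ j < c"
    "\<And>j. j \<ge> J1 \<Longrightarrow> (2 powr (- (t - r))) ^ j < 1 / 4" "\<And>j. j \<ge> J1 \<Longrightarrow> J0 \<le> j" "\<And>j. j \<ge> J1 \<Longrightarrow> p < j"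
    unfolding eventually_sequentially by blast
  show thesis
  proof (rule that[OF C, of J1])
    fix j n :: nat and \<phi> :: "(nat \<Rightarrow> (real^'d) \<times> bool) \<Rightarrow> nat" and \<epsilon> :: real
    assume j: "j \<ge> J1" and \<phi>: "\<phi> \<in> tests n" and \<epsilon>: "\<epsilon> \<le> M / 4 * 2 powr (- (real j * r))"
    note jJ = J1(3)[OF j] and jp = J1(4)[OF j]
    obtain I where I: "I \<subseteq> wav_idx W j" "finite I" "card I = 2 ^ (j - p - 1)"
      "\<And>y. (\<Sum>k\<in>I. \<bar>wav_fun W j k y\<bar>) \<le> A * 2 powr (real j / 2)"
      using block[OF jp] by blast
    define \<Lambda> where "\<Lambda> = {\<kappa> :: 'd \<Rightarrow> bindex. \<forall>l. \<kappa> l \<in> I}"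
    define e where "e = (\<lambda>\<kappa> (x::real^'d). \<Prod>l\<in>UNIV. wav_fun W j (\<kappa> l) (x $ l))"
    define K where "K = (2::real) powr ((real j - real (p + 1)) * real ?d)"
    define \<gamma> where "\<gamma> = b * 2 powr (- (real j * r)) / sqrt K"
    define h where "h \<beta> x = \<gamma> * (\<Sum>\<kappa>\<in>\<Lambda>. \<beta> \<kappa> * e \<kappa> x)" for \<beta> x
    let ?B = "PiE \<Lambda> (\<lambda>_. {-1, 1::real})"
    have K: "K > 0" by (simp add: K_def)
    have \<Lambda>_PiE: "\<Lambda> = PiE UNIV (\<lambda>_. I)" by (auto simp: \<Lambda>_def PiE_iff)
    have fin: "finite \<Lambda>" unfolding \<Lambda>_PiE using I by (intro finite_PiE) auto
    have "real (card \<Lambda>) = (2 ^ (j - p - 1)) ^ ?d"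
      unfolding \<Lambda>_PiE using I by (simp add: card_PiE)
    also have "\<dots> = K"
      using jp by (simp add: K_def powr_realpow[symmetric] powr_powr of_nat_diff)
    finally have card: "real (card \<Lambda>) = K" .
    note det = wavelet_tensor_detail[OF jJ I(1), where 'd='d, folded \<Lambda>_def e_def]
    have \<gamma>2: "\<gamma>\<^sup>2 = b\<^sup>2 * 2 powr (- (2 * real j * r)) / K"
      using K by (simp add: \<gamma>_def power_divide power_mult_distrib powr_power mult.assoc)
    have h_det: "h \<beta> \<in> detail j" for \<beta> 
      using wavelet_tensor_detail(2)[OF jJ I(1), where 'd='d, of \<gamma> \<beta>] unfolding h_def \<Lambda>_def e_def .
    have h_norm: "l2_norm unit_cube (h \<beta>) = b * 2 powr (- (real j * r))" if \<beta>: "\<beta> \<in> ?B" for \<beta>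
    proof -
      have "(l2_norm unit_cube (h \<beta>))\<^sup>2 = \<gamma>\<^sup>2 * l2_inner unit_cube
          (\<lambda>x. \<Sum>\<kappa>\<in>\<Lambda>. \<beta> \<kappa> * e \<kappa> x) (\<lambda>x. \<Sum>\<kappa>\<in>\<Lambda>. \<beta> \<kappa> * e \<kappa> x)"
        unfolding l2_norm_power2 h_def l2_inner_scale_left
        by (subst l2_inner_commute, subst l2_inner_scale_left) (simp add: power2_eq_square)
      also have "\<dots> = \<gamma>\<^sup>2 * (\<Sum>\<kappa>\<in>\<Lambda>. \<beta> \<kappa> * \<beta> \<kappa>)"
        by (subst l2_inner_orthonormal_sums[OF det(1) fin]) simp
      also have "(\<Sum>\<kappa>\<in>\<Lambda>. \<beta> \<kappa> * \<beta> \<kappa>) = (\<Sum>\<kappa>\<in>\<Lambda>. 1)"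
        using \<beta> by (intro sum.cong refl) (auto simp: PiE_iff)
      also have "\<gamma>\<^sup>2 * (\<Sum>\<kappa>\<in>\<Lambda>. 1) = (b * 2 powr (- (real j * r)))\<^sup>2"
        using K by (simp add: card \<gamma>2 power_mult_distrib powr_power mult.assoc)
      finally show ?thesis using b by (subst (asm) power2_eq_iff_nonneg) (auto simp: l2_norm_nonneg)
    qed
    have h_sup: "\<bar>h \<beta> x\<bar> \<le> c" if \<beta>: "\<beta> \<in> ?B" for \<beta> x
    proof -
      have "\<bar>\<Sum>\<kappa>\<in>\<Lambda>. \<beta> \<kappa> * e \<kappa> x\<bar> \<le> (\<Sum>\<kappa>\<in>\<Lambda>. \<bar>\<beta> \<kappa> * e \<kappa> x\<bar>)" by (rule sum_abs)
      also have "\<dots> = (\<Sum>\<kappa>\<in>\<Lambda>. \<Prod>l\<in>UNIV. \<bar>wav_fun W j (\<kappa> l) (x $ l)\<bar>)"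
        using \<beta> by (intro sum.cong refl) (auto simp: PiE_iff e_def abs_mult abs_prod)
      also have "\<dots> = (\<Prod>l\<in>(UNIV::'d set). \<Sum>k\<in>I. \<bar>wav_fun W j k (x $ l)\<bar>)"
        unfolding \<Lambda>_PiE using I by (intro prod_sum_PiE[symmetric]) auto
      also have "\<dots> \<le> (\<Prod>l\<in>(UNIV::'d set). A * 2 powr (real j / 2))"
        using I(4) by (intro prod_mono) (auto intro: sum_nonneg)
      also have "\<dots> = A ^ ?d * 2 powr (real j * real ?d / 2)"
        by (simp add: power_mult_distrib powr_power mult.commute[of "real j"])
      finally have s: "\<bar>\<Sum>\<kappa>\<in>\<Lambda>. \<beta> \<kappa> * e \<kappa> x\<bar> \<le> A ^ ?d * 2 powr (real j * real ?d / 2)" .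
      have \<gamma>0: "\<gamma> \<ge> 0" using b K by (simp add: \<gamma>_def)
      have "\<bar>h \<beta> x\<bar> \<le> \<gamma> * (A ^ ?d * 2 powr (real j * real ?d / 2))"
        unfolding h_def abs_mult using s \<gamma>0 by (simp add: mult_left_mono)
      also have "\<dots> = D * (2 powr (- r)) ^ j"
      proof -
        have "sqrt K = 2 powr ((real j - real (p + 1)) * real ?d / 2)"
          unfolding K_def by (simp add: powr_half_sqrt[symmetric] powr_powr)
        also have "\<dots> = 2 powr (real j * real ?d / 2) / 2 powr (real (p + 1) * real ?d / 2)"
          unfolding powr_diff[symmetric] by (simp add: algebra_simps diff_divide_distrib)
        finally have sK: "sqrt K = 2 powr (real j * real ?d / 2) / 2 powr (real (p + 1) * real ?d / 2)" .
        have "(2 powr (- r)) ^ j = (2::real) powr (- (real j * r))" by (simp add: powr_power mult.commute)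
        then show ?thesis unfolding \<gamma>_def sK D_def by simp
      qed
      also have "\<dots> \<le> c" using J1(1)[OF j] by simp
      finally show ?thesis .
    qed
    have ball_ne: "(besov_ball W t M :: (real^'d \<Rightarrow> real) set) \<noteq> {}"
    proof -
      have "2 powr (real J0 * t) * c \<le> 2 powr (real J0 * S) * c"
        using S c by (intro mult_right_mono powr_mono mult_left_mono) auto
      then have "2 powr (real J0 * t) * c \<le> M" using c S by linarith
      then show ?thesis using const_mem_besov_ball[of c t M, where 'd='d] c by auto
    qed
    have alt: "(\<lambda>x. c + h \<beta> x) \<in> {f \<in> regression_class W r M. l2_dist_set unit_cube f (besov_ball W t M) \<ge> \<epsilon>}"
      if \<beta>: "\<beta> \<in> ?B" for \<beta>
    proof -
      have hl: "h \<beta> \<in> l2_set unit_cube" using h_det[of \<beta>] V_cube_l2 by (auto simp: detail_def)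
      interpret U: prob_space "unit_cube :: (real^'d) measure" by (rule prob_space_unit_cube)
      have fl: "(\<lambda>x. c + h \<beta> x) \<in> l2_set unit_cube"
        by (intro l2_set_add hl) (simp add: l2_set_def)
      have "2 powr (real J0 * r) * c \<le> 2 powr (real J0 * S) * c"
        using S c by (intro mult_right_mono powr_mono mult_left_mono) auto
      moreover have "2 powr (real j * r) * l2_norm unit_cube (h \<beta>) = M / 2"
        unfolding h_norm[OF \<beta>] by (simp add: b_def powr_minus field_simps)
      ultimately have "2 powr (real J0 * r) * c + 2 powr (real j * r) * l2_norm unit_cube (h \<beta>) \<le> M"
        using c by linarith
      then have "besov_norm W r (\<lambda>x. c + h \<beta> x) \<le> ennreal M"
        using besov_norm_const_plus_detail[OF jJ h_det[of \<beta>], of c r] c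
        by (meson ennreal_leI less_imp_le order_trans)
      moreover have "0 \<le> c + h \<beta> x \<and> c + h \<beta> x \<le> 1" for x
        using h_sup[OF \<beta>, of x] c by linarith
      ultimately have mem: "(\<lambda>x. c + h \<beta> x) \<in> regression_class W r M"
        using fl by (auto simp: regression_class_def besov_ball_def)
      have "(2 powr (- (t - r))) ^ j = (2::real) powr (- (real j * t)) / 2 powr (- (real j * r))"
        unfolding powr_diff[symmetric] by (simp add: powr_power algebra_simps)
      then have "2 powr (- (real j * t)) = (2 powr (- (t - r))) ^ j * (2::real) powr (- (real j * r))"
        by simp
      also have "\<dots> \<le> 1 / 4 * 2 powr (- (real j * r))"
        using J1(2)[OF j] by (intro mult_right_mono) auto
      finally have "2 powr (- (real j * t)) \<le> 1 / 4 * 2 powr (- (real j * r))" .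
      then have "M * 2 powr (- (real j * t)) \<le> M * (1 / 4 * 2 powr (- (real j * r)))"
        using S by (intro mult_left_mono) auto
      then have "\<epsilon> \<le> l2_norm unit_cube (h \<beta>) - M * 2 powr (- (real j * t))"
        using \<epsilon> unfolding h_norm[OF \<beta>] b_def by simp
      also have "\<dots> \<le> l2_dist_set unit_cube (\<lambda>x. c + h \<beta> x) (besov_ball W t M)"
        using S by (intro l2_dist_besov_ball_ge[OF jJ h_det _ ball_ne]) auto
      finally show ?thesis using mem by simp
    qed
    have "real (card \<Lambda>) * (n * \<gamma>\<^sup>2 / (c * (1 - c)))\<^sup>2 / 2
        = b ^ 4 * (real n)\<^sup>2 * (2 powr (- (4 * real j * r)) / K) / (c * (1 - c))\<^sup>2 / 2"
    proof -
      have "(2 powr (- (2 * real j * r)))\<^sup>2 = (2::real) powr (- (4 * real j * r))"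
        by (simp add: powr_power mult.assoc)
      moreover have "K * (n * (b\<^sup>2 * E / K) / cc)\<^sup>2 / 2 = b ^ 4 * (real n)\<^sup>2 * (E\<^sup>2 / K) / cc\<^sup>2 / 2" for E cc
      proof -
        have "(n * (b\<^sup>2 * E / K) / cc)\<^sup>2 = (real n)\<^sup>2 * (b\<^sup>2)\<^sup>2 * E\<^sup>2 / (K * K) / cc\<^sup>2"
          by (simp add: power_mult_distrib power_divide power2_eq_square mult_ac)
        then show ?thesis using K by simp
      qed
      ultimately show ?thesis unfolding card \<gamma>2 by metis
    qed
    also have "2 powr (- (4 * real j * r)) / K
        = 2 powr (real (p + 1) * real ?d) * 2 powr (- (real j * (4 * r + real ?d)))"
      unfolding K_def powr_diff[symmetric] powr_add[symmetric] by (simp add: algebra_simps)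
    finally have chi: "real (card \<Lambda>) * (n * \<gamma>\<^sup>2 / (c * (1 - c)))\<^sup>2 / 2
      = C * (real n)\<^sup>2 * 2 powr (- (real j * (4 * r + real ?d)))"
      by (simp add: C_def)
    have "ennreal (1 - sqrt (exp (C * (real n)\<^sup>2 * 2 powr (- (real j * (4 * r + real ?d)))) - 1)) \<le>
       emeasure (sample_law n (\<lambda>_::real^'d. c) (\<lambda>_. 1))
          {\<omega> \<in> space (sample_law n (\<lambda>_. c) (\<lambda>_. 1)). \<phi> \<omega> = 1} +
       (SUP \<beta>\<in>?B. emeasure (sample_law n (\<lambda>x. c + h \<beta> x) (\<lambda>_. 1))
          {\<omega> \<in> space (sample_law n (\<lambda>x. c + h \<beta> x) (\<lambda>_. 1)). \<phi> \<omega> = 0})"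
      unfolding chi[symmetric] h_def
      by (rule ingster_lower_bound[OF c(1,2) fin det(1) _ \<phi>]) (use h_sup in \<open>simp add: h_def\<close>)
    also have "\<dots> \<le> error_sum n (\<lambda>_::real^'d. c)
          {f \<in> regression_class W r M. l2_dist_set unit_cube f (besov_ball W t M) \<ge> \<epsilon>} \<phi>"
      by (intro add_left_mono SUP_least SUP_upper alt)
    finally show "ennreal (1 - sqrt (exp (C * (real n)\<^sup>2 * 2 powr (- (real j * (4 * r + real ?d)))) - 1)) \<le>
       error_sum n (\<lambda>_::real^'d. c)
          {f \<in> regression_class W r M. l2_dist_set unit_cube f (besov_ball W t M) \<ge> \<epsilon>} \<phi>" .
  qed
qed

end

text \<open>The level is the least one with \<open>2\<^sup>j \<ge> X n\<close>, where \<open>X n\<close> solves \<open>C n\<^sup>2 / X n powr (4 r + d) = v\<close>.  Rounding up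
costs at most a factor \<open>2\<close> in \<open>2\<^sup>j\<close>, so \<open>2\<^sup>-\<^sup>j\<^sup>r\<close> is still a constant multiple of the testing rate; that constant does not
depend on the threshold \<open>J1\<close>.\<close>

lemma resolution_level_exists:
  fixes r d C v :: real
  assumes r: "r > 0" and d: "d > 0" and C: "C > 0" and v: "v > 0"
  obtains \<eta> where "\<eta> > 0"
    "\<And>J1. \<forall>\<^sub>F n in sequentially. \<exists>j\<ge>J1. C * (real n)\<^sup>2 * 2 powr (- (real j * (4 * r + d))) \<le> v
        \<and> \<eta> * real n powr (- 2 * r / (4 * r + d)) \<le> 2 powr (- (real j * r))"
proof -
  define a where "a = 4 * r + d"
  have a: "a > 0" using r d by (simp add: a_def)
  define X where "X n = (C / v * (real n)\<^sup>2) powr (1 / a)" for n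
  have lim: "filterlim X at_top sequentially"
    unfolding X_def using a C v by real_asymp
  define \<eta> where "\<eta> = 2 powr (- r) * (C / v) powr (- r / a)"
  have *: "\<forall>\<^sub>F n in sequentially. \<exists>j\<ge>J1. C * (real n)\<^sup>2 * 2 powr (- (real j * (4 * r + d))) \<le> v
        \<and> \<eta> * real n powr (- 2 * r / (4 * r + d)) \<le> 2 powr (- (real j * r))" for J1
    using filterlim_at_top[THEN iffD1, OF lim, rule_format, of "2 ^ J1"] eventually_gt_at_top[of 0]
  proof eventually_elim
    case (elim n)
    have X1: "1 \<le> X n" using elim(1) by (meson one_le_power one_le_numeral order_trans)
    define j where "j = nat \<lceil>log 2 (X n)\<rceil>"
    have lj: "log 2 (X n) \<le> real j" "real j < log 2 (X n) + 1"
      unfolding j_def using X1 by (auto simp: of_nat_nat) linarith+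
    have "2 powr log 2 (X n) \<le> 2 powr real j" using lj by (intro powr_mono) auto
    then have Xj: "X n \<le> 2 powr real j" using X1 by simp
    have "2 powr real j \<le> 2 powr (log 2 (X n) + 1)" using lj by (intro powr_mono) auto
    then have jX: "2 powr real j \<le> 2 * X n" using X1 by (simp add: powr_add)
    have "(2::real) powr real j = 2 ^ j" by (simp add: powr_realpow)
    then have "(2::real) ^ J1 \<le> 2 ^ j" using elim(1) Xj by linarith
    then have "j \<ge> J1" by simp
    moreover have "C * (real n)\<^sup>2 * 2 powr (- (real j * a)) \<le> v"
    proof -
      have "C / v * (real n)\<^sup>2 = X n powr a"
        unfolding X_def using a C v elim(2) by (simp add: powr_powr)
      also have "\<dots> \<le> (2 powr real j) powr a" using Xj X1 a by (intro powr_mono2) auto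
      also have "\<dots> = 2 powr (real j * a)" by (simp add: powr_powr)
      finally show ?thesis using v by (simp add: powr_minus field_simps)
    qed
    moreover have "\<eta> * real n powr (- 2 * r / a) \<le> 2 powr (- (real j * r))"
    proof -
      have "\<eta> * real n powr (- 2 * r / a) = (2 * X n) powr (- r)"
      proof -
        have "(real n)\<^sup>2 = real n powr 2" using elim(2) by simp
        then have "X n powr (- r) = (C / v) powr (- r / a) * real n powr (- 2 * r / a)"
          unfolding X_def powr_powr using C v elim(2)
          by (subst powr_mult) (simp_all add: powr_powr del: powr_numeral)
        then show ?thesis using X1 by (simp add: \<eta>_def powr_mult)
      qed
      also have "\<dots> \<le> (2 powr real j) powr (- r)" using jX r by (intro powr_mono2') auto
      also have "\<dots> = 2 powr (- (real j * r))" by (simp add: powr_powr)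
      finally show ?thesis .
    qed
    ultimately show ?case unfolding a_def by blast
  qed
  have "\<eta> > 0" using C v by (simp add: \<eta>_def)
  then show thesis using * by (rule that)
qed

lemma rejecting_test_error_le_1:
  fixes c :: real
  assumes "0 < c" "c \<le> 1/2"
  shows "(INF \<phi>\<in>tests n.
          error_sum n (\<lambda>_::real^'d. c)
          F \<phi>) \<le> 1"
proof (rule INF_lower2)
  show "(\<lambda>_. 1) \<in> tests n" by (simp add: tests_def)
  interpret P: prob_space "sample_law n (\<lambda>_::real^'d. c) (\<lambda>_. 1)"
    unfolding sample_law_def using assms by (intro prob_space_PiM prob_space_pair_law) auto
  have "(SUP f\<in>F. 0 :: ennreal) \<le> 0" by (intro SUP_least) simp
  then show "emeasure (sample_law n (\<lambda>_::real^'d. c) (\<lambda>_. 1))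
            {\<omega> \<in> space (sample_law n (\<lambda>_. c) (\<lambda>_. 1)). (1::nat) = 1} +
          (SUP f\<in>F. emeasure (sample_law n f (\<lambda>_. 1))
               {\<omega> \<in> space (sample_law n f (\<lambda>_. 1)). (1::nat) = 0}) \<le> 1"
    by (simp add: P.emeasure_space_1)
qed

theorem theorem5p1:
  fixes W :: cdv_data and N\<^sub>w :: nat and R\<^sub>w S r t M :: real
  assumes "S > 0"
    and "cdv_system N\<^sub>w R\<^sub>w W" and "R\<^sub>w > S" and "real N\<^sub>w > S"
    and "0 < r" and "r < t" and "t < S" and "M > 0"
  shows "\<exists>f\<^sub>0 :: real ^ 'd \<Rightarrow> real.
     f\<^sub>0 \<in> (\<Inter>u\<in>{0<..<S}. regression_class W u M) \<and>
     (\<forall>\<delta> :: nat \<Rightarrow> real. (\<forall>n. \<delta> n > 0) \<and> \<delta> \<in> o(\<lambda>n. testing_rate CARD('d) r n) \<longrightarrow>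
       (\<lambda>n. INF \<phi>\<in>tests n.
          emeasure (sample_law n f\<^sub>0 (\<lambda>_. 1))
            {\<omega> \<in> space (sample_law n f\<^sub>0 (\<lambda>_. 1)). \<phi> \<omega> = 1} +
          (SUP f\<in>{f \<in> regression_class W r M.
                   l2_dist_set unit_cube f (besov_ball W t M) \<ge> \<delta> n}.
             emeasure (sample_law n f (\<lambda>_. 1))
               {\<omega> \<in> space (sample_law n f (\<lambda>_. 1)). \<phi> \<omega> = 0}))
       \<longlonglongrightarrow> 1)"
proof -
  interpret cdv W N\<^sub>w R\<^sub>w by standard fact
  \<comment> \<open>the bound \<open>1 / 2\<close> leaves room for perturbations of size \<open>c\<close>, the other one half of the Besov radius\<close>
  define c where "c = min (1 / 2) (M / 2 / 2 powr (real J0 * S))"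
  have c: "0 < c" "c \<le> 1/2" "2 powr (real J0 * S) * c \<le> M / 2"
    using \<open>M > 0\<close> by (auto simp: c_def min_def field_simps)
  have mem: "(\<lambda>_::real^'d. c) \<in> regression_class W u M" if "u \<in> {0<..<S}" for u
  proof -
    have "2 powr (real J0 * u) * c \<le> 2 powr (real J0 * S) * c"
      using that c by (intro mult_right_mono powr_mono mult_left_mono) auto
    then have "2 powr (real J0 * u) * c \<le> M" using c \<open>M > 0\<close> by linarith
    then show ?thesis using const_mem_besov_ball[of c u M, where 'd='d] c by (simp add: regression_class_def)
  qed
  obtain J1 C where C: "C > 0" and risk:
    "\<And>j n \<phi> \<epsilon>. j \<ge> J1 \<Longrightarrow> \<phi> \<in> tests n \<Longrightarrow> \<epsilon> \<le> M / 4 * 2 powr (- (real j * r)) \<Longrightarrow>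
      ennreal (1 - sqrt (exp (C * (real n)\<^sup>2 * 2 powr (- (real j * (4 * r + real CARD('d))))) - 1)) \<le>
        error_sum n (\<lambda>_::real^'d. c)
          {f \<in> regression_class W r M. l2_dist_set unit_cube f (besov_ball W t M) \<ge> \<epsilon>} \<phi>"
    by (rule rademacher_alternatives[OF assms(1,5,6,7,8) c, where 'd='d]) (rule that)
  show ?thesis
  proof (intro exI[of _ "\<lambda>_. c"] conjI allI impI)
    show "(\<lambda>_::real^'d. c) \<in> (\<Inter>u\<in>{0<..<S}. regression_class W u M)" using mem by blast
    fix \<delta> :: "nat \<Rightarrow> real" assume \<delta>: "(\<forall>n. \<delta> n > 0) \<and> \<delta> \<in> o(\<lambda>n. testing_rate CARD('d) r n)"
    let ?R = "\<lambda>n. INF \<phi>\<in>tests n.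
          error_sum n (\<lambda>_::real^'d. c)
          {f \<in> regression_class W r M. l2_dist_set unit_cube f (besov_ball W t M) \<ge> \<delta> n} \<phi>"
    have lower: "\<forall>\<^sub>F n in sequentially. ennreal (1 - \<epsilon>) \<le> ?R n" if \<epsilon>: "\<epsilon> > 0" for \<epsilon> :: real
    proof -
      \<comment> \<open>a second moment of at most \<open>1 + \<epsilon>\<^sup>2\<close> leaves an error sum of at least \<open>1 - \<epsilon>\<close>\<close>
      have v: "ln (1 + \<epsilon>\<^sup>2) > 0" using \<epsilon> by (intro ln_gt_zero) simp
      have d: "real CARD('d) > 0" by simp
      obtain \<eta> where \<eta>: "\<eta> > 0" and level:
        "\<And>J1. \<forall>\<^sub>F n in sequentially. \<exists>j\<ge>J1. C * (real n)\<^sup>2 * 2 powr (- (real j * (4 * r + real CARD('d)))) \<le> ln (1 + \<epsilon>\<^sup>2)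
          \<and> \<eta> * real n powr (- 2 * r / (4 * r + real CARD('d))) \<le> 2 powr (- (real j * r))"
        by (rule resolution_level_exists[OF \<open>0 < r\<close> d C v]) (rule that)
      have "\<forall>\<^sub>F n in sequentially. norm (\<delta> n) \<le> (M / 4 * \<eta>) * norm (testing_rate CARD('d) r n)"
        using \<delta> \<eta> \<open>M > 0\<close> by (intro landau_o.smallD) auto
      with level[of J1] show ?thesis
      proof eventually_elim
        case (elim n)
        then obtain j where j: "j \<ge> J1"
          "C * (real n)\<^sup>2 * 2 powr (- (real j * (4 * r + real CARD('d)))) \<le> ln (1 + \<epsilon>\<^sup>2)"
          "\<eta> * real n powr (- 2 * r / (4 * r + real CARD('d))) \<le> 2 powr (- (real j * r))" by blast
        have "\<delta> n \<le> M / 4 * (\<eta> * testing_rate CARD('d) r n)"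
          using elim(2) by (simp add: testing_rate_def)
        also have "\<dots> \<le> M / 4 * 2 powr (- (real j * r))"
          using j(3) \<open>M > 0\<close> unfolding testing_rate_def by (intro mult_left_mono) auto
        finally have \<delta>j: "\<delta> n \<le> M / 4 * 2 powr (- (real j * r))" .
        have "exp (C * (real n)\<^sup>2 * 2 powr (- (real j * (4 * r + real CARD('d))))) \<le> exp (ln (1 + \<epsilon>\<^sup>2))"
          using j(2) by simp
        also have "\<dots> = 1 + \<epsilon>\<^sup>2" by (intro exp_ln add_pos_nonneg) auto
        finally have "sqrt (exp (C * (real n)\<^sup>2 * 2 powr (- (real j * (4 * r + real CARD('d))))) - 1) \<le> \<epsilon>"
          using \<epsilon> by (intro real_le_lsqrt) auto
        then have "ennreal (1 - \<epsilon>)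
          \<le> ennreal (1 - sqrt (exp (C * (real n)\<^sup>2 * 2 powr (- (real j * (4 * r + real CARD('d))))) - 1))"
          by (intro ennreal_leI) simp
        also have "\<dots> \<le> ?R n"
          by (intro INF_greatest risk j(1) \<delta>j)
        finally show ?case .
      qed
    qed
    show "?R \<longlonglongrightarrow> 1"
    proof (rule order_tendstoI)
      fix a :: ennreal assume "a < 1"
      then obtain a' where a': "a = ennreal a'" "0 \<le> a'" "a' < 1"
        by (cases a) (auto simp: ennreal_less_iff simp flip: ennreal_1)
      have "\<forall>\<^sub>F n in sequentially. ennreal (1 - (1 - a') / 2) \<le> ?R n" using a' by (intro lower) simp
      then show "\<forall>\<^sub>F n in sequentially. a < ?R n"
      proof eventually_elim
        case (elim n)
        have "a' < 1 - (1 - a') / 2" using a'(3) by (simp add: field_simps)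
        then have "a < ennreal (1 - (1 - a') / 2)" using a' by (simp add: ennreal_less_iff)
        also note elim
        finally show ?case .
      qed
    next
      fix a :: ennreal assume "1 < a"
      then show "\<forall>\<^sub>F n in sequentially. ?R n < a"
        using rejecting_test_error_le_1[OF c(1,2)] by (intro always_eventually allI) (rule le_less_trans)
    qed
  qed
qed

end
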